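(* Let $N\ge1$ and assume that $\frac{2N+4}{N}<p<\frac{2N}{N-2}$ if $N\ge3$, and $\frac{2N+4}{N}<p$ if $N=1,2$. Then the function $c\mapsto\tilde\gamma(c)$ is strictly decreasing on $(0,\infty)$. In addition, $$\tilde\gamma(c)\to+\infty\ \text{ as }c\to0,\qquad\tilde\gamma(c)\to0\ \text{ as }c\to\infty.$$
   Context: For $u\in H^1(\mathbb{R}^N)$ let $\tilde F(u)=\frac12\|\nabla u\|_2^2-\frac1p\|u\|_p^p$, and for $c>0$ let $S(c)=\{u\in H^1(\mathbb{R}^N):\|u\|_2^2=c\}$. Under the stated condition on $p$ it is known (Jeanjean) that $\tilde F$ has a mountain pass geometry on $S(c)$: there exists $K_c>0$ such that $$\tilde\gamma(c)=\inf_{g\in\tilde\Gamma_c}\max_{t\in[0,1]}\tilde F(g(t))>\max\{\tilde F(g(0)),\tilde F(g(1))\}$$ for every $g\in\tilde\Gamma_c=\{g\in C([0,1],S(c)):\ g(0)\in A_{K_c},\ \tilde F(g(1))<0\}$, where $A_{K_c}=\{u\in S(c):\|\nabla u\|_2^2\le K_c\}$. With such a $K_c$ fixed, $\tilde\gamma(c)$ is the mountain pass level. *)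

theory Defs
  imports "HOL-Analysis.Analysis"
begin

section \<open>Lebesgue and Sobolev spaces on Euclidean space\<close>

text \<open>Elements of $L^q$ and $H^1$ are represented by Borel measurable functions instead of
  classes modulo equality almost everywhere; every class has a Borel representative, and
  everything below depends on a function only through its class.\<close>

definition Lp_space :: "real \<Rightarrow> ('a::euclidean_space \<Rightarrow> 'b::euclidean_space) set" where
  "Lp_space q = {f \<in> borel_measurable lborel. integrable lborel (\<lambda>x. norm (f x) powr q)}"

definition Lp_norm :: "real \<Rightarrow> ('a::euclidean_space \<Rightarrow> 'b::euclidean_space) \<Rightarrow> real" where
  "Lp_norm q f = (LINT x|lborel. norm (f x) powr q) powr (1 / q)"

definition partial_deriv :: "'n \<Rightarrow> (real ^ 'n \<Rightarrow> real) \<Rightarrow> real ^ 'n \<Rightarrow> real" where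
  "partial_deriv i f = (\<lambda>x. frechet_derivative f (at x) (axis i 1))"

primrec C_class :: "nat \<Rightarrow> (real ^ 'n \<Rightarrow> real) \<Rightarrow> bool" where
  "C_class 0 f \<longleftrightarrow> continuous_on UNIV f"
| "C_class (Suc k) f \<longleftrightarrow>
     (\<forall>x. f differentiable (at x)) \<and> (\<forall>i. C_class k (partial_deriv i f))"

definition test_functions :: "(real ^ 'n \<Rightarrow> real) set" where
  "test_functions = {\<phi>. (\<forall>k. C_class k \<phi>) \<and> compact (closure {x. \<phi> x \<noteq> 0})}"

definition is_weak_gradient :: "(real ^ 'n \<Rightarrow> real) \<Rightarrow> (real ^ 'n \<Rightarrow> real ^ 'n) \<Rightarrow> bool" where
  "is_weak_gradient u v \<longleftrightarrow>
     (\<forall>\<phi>\<in>test_functions. \<forall>i.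
        (LINT x|lborel. u x * partial_deriv i \<phi> x) = - (LINT x|lborel. v x $ i * \<phi> x))"

definition H1 :: "(real ^ 'n \<Rightarrow> real) set" where
  "H1 = {u \<in> Lp_space 2. \<exists>v\<in>Lp_space 2. is_weak_gradient u v}"

text \<open>For $u \in H^1$ the choice below is unique up to equality almost everywhere.\<close>

definition weak_grad :: "(real ^ 'n \<Rightarrow> real) \<Rightarrow> real ^ 'n \<Rightarrow> real ^ 'n" where
  "weak_grad u = (SOME v. v \<in> Lp_space 2 \<and> is_weak_gradient u v)"

definition H1_norm :: "(real ^ 'n \<Rightarrow> real) \<Rightarrow> real" where
  "H1_norm u = sqrt ((Lp_norm 2 u)\<^sup>2 + (Lp_norm 2 (weak_grad u))\<^sup>2)"

section \<open>The energy functional and its mountain pass level\<close>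

text \<open>In the range of \<open>p\<close> considered, $H^1 \subseteq L^p$ by the Sobolev embedding.\<close>

definition energy :: "real \<Rightarrow> (real ^ 'n \<Rightarrow> real) \<Rightarrow> real" where
  "energy p u = 1 / 2 * (Lp_norm 2 (weak_grad u))\<^sup>2 - 1 / p * Lp_norm p u powr p"

definition mass_sphere :: "real \<Rightarrow> (real ^ 'n \<Rightarrow> real) set" where
  "mass_sphere c = {u \<in> H1. (Lp_norm 2 u)\<^sup>2 = c}"

definition small_grad_set :: "real \<Rightarrow> real \<Rightarrow> (real ^ 'n \<Rightarrow> real) set" where
  "small_grad_set K c = {u \<in> mass_sphere c. (Lp_norm 2 (weak_grad u))\<^sup>2 \<le> K}"

definition continuous_H1_path :: "(real \<Rightarrow> real ^ 'n \<Rightarrow> real) \<Rightarrow> bool" where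
  "continuous_H1_path g \<longleftrightarrow>
     (\<forall>t\<in>{0..1}. ((\<lambda>s. H1_norm (\<lambda>x. g s x - g t x)) \<longlongrightarrow> 0) (at t within {0..1}))"

definition mp_paths :: "real \<Rightarrow> real \<Rightarrow> real \<Rightarrow> (real \<Rightarrow> real ^ 'n \<Rightarrow> real) set" where
  "mp_paths p K c =
     {g. continuous_H1_path g \<and> (\<forall>t\<in>{0..1}. g t \<in> mass_sphere c) \<and>
         g 0 \<in> small_grad_set K c \<and> energy p (g 1) < 0}"

text \<open>The infimum and the supremum are taken in the extended reals, where they always exist.
  The supremum is the maximum of the paper, the energy being continuous along a path. The
  argument of type \<open>'n itself\<close> only records the dimension \<open>N = CARD('n)\<close>.\<close>

definition mp_level :: "'n::finite itself \<Rightarrow> real \<Rightarrow> real \<Rightarrow> real \<Rightarrow> ereal" where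
  "mp_level _ p K c =
     (INF g \<in> (mp_paths p K c :: (real \<Rightarrow> real ^ 'n \<Rightarrow> real) set).
        SUP t\<in>{0..1}. ereal (energy p (g t)))"

definition mp_geometry :: "'n::finite itself \<Rightarrow> real \<Rightarrow> real \<Rightarrow> real \<Rightarrow> bool" where
  "mp_geometry T p K c \<longleftrightarrow>
     K > 0 \<and>
     (\<forall>g \<in> (mp_paths p K c :: (real \<Rightarrow> real ^ 'n \<Rightarrow> real) set).
        mp_level T p K c > ereal (max (energy p (g 0)) (energy p (g 1))))"

end

theory Submission
  imports Defs "HOL-Real_Asymp.Real_Asymp"
begin

text \<open>
  The nonlinearity is a pure power, so the whole problem is homogeneous: one two-parameter rescaling
  \<open>u \<mapsto> a * u (b x)\<close> multiplies the squared gradient and the \<open>p\<close>-th power of the $L^p$ norm by the same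
  factor once \<open>b\<close> is chosen as a suitable power of \<open>a\<close>. It multiplies the energy by that factor, a
  positive power of \<open>a\<close>, and the mass by a negative power of \<open>a\<close>. If the level depended on the mass
  alone, it would therefore equal \<open>L * c powr (- \<kappa>)\<close> with constants
  \<open>L, \<kappa> > 0\<close> (\<open>mp_level_power_law\<close>), and the three claims are properties of this function.

  The level also depends on the bound \<open>K c\<close> for the gradient at the start of a path, and this bound
  is an arbitrary function of \<open>c\<close>. The key point is that a bound for which the mountain pass geometry
  holds may be decreased without changing the level (\<open>mp_level_shrink\<close>). The reason is the shape of the
  energy along the mass-preserving dilation \<open>dilate t u\<close>: it is
  \<open>\<alpha> * t\<^sup>2 - \<beta> * t powr \<sigma>\<close> with \<open>\<sigma> > 2\<close>, which rises to one maximum and then falls. A starting point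
  beyond its maximum could be dilated down to negative energy without ever rising above its initial
  energy, contradicting the geometry (\<open>mp_geometry_dilate_energy_le\<close>). So no starting point
  lies beyond its maximum, and it can be reached from points of arbitrarily small gradient along a
  dilation on which the energy stays below its value there.

  That the constant \<open>L\<close> is positive and finite is seen on the dilation path of one bump function
  (\<open>mp_level_finite_pos\<close>); positivity again comes from the geometry.

  The analytic input is threefold. Weak gradients are unique almost everywhere
  (\<open>weak_gradient_unique\<close>), so that the gradient of a rescaled function is the rescaled gradient; this
  rests on the fundamental lemma of the calculus of variations, hence on smooth bumps approximating
  indicator functions of boxes. Dilations act continuously on square-integrable functions
  (\<open>L2_dilation_continuous\<close>), so that the dilation of an arbitrary element of $H^1$ is a continuous path.
  Finally, test functions belong to $H^1$, by integration by parts.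
\<close>

section \<open>Smooth functions and test functions\<close>

lemma partial_deriv_eq:
  assumes "(f has_derivative D) (at x)"
  shows "partial_deriv i f x = D (axis i 1)"
  using frechet_derivative_at[OF assms] unfolding partial_deriv_def by metis

lemma C_class_SucD: "C_class (Suc k) f \<Longrightarrow> C_class k f"
proof (induction k arbitrary: f)
  case 0
  then show ?case
    by (auto intro!: continuous_at_imp_continuous_on differentiable_imp_continuous_within)
qed auto

lemma C_class_const: "C_class k (\<lambda>x::real^'n. r)"
proof (induction k arbitrary: r)
  case (Suc k)
  have "partial_deriv i (\<lambda>x::real^'n. r) = (\<lambda>x. 0)" for i
    by (rule ext) (rule partial_deriv_eq, rule has_derivative_const)
  then show ?case using Suc by simp
qed simp

lemma C_class_add:
  "C_class k f \<Longrightarrow> C_class k g \<Longrightarrow> C_class k (\<lambda>x. f x + g x)"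
proof (induction k arbitrary: f g)
  case 0
  then show ?case by (auto intro: continuous_intros)
next
  case (Suc k)
  have "partial_deriv i (\<lambda>x. f x + g x) = (\<lambda>x. partial_deriv i f x + partial_deriv i g x)" for i
  proof
    fix x
    have "f differentiable (at x)" "g differentiable (at x)" using Suc.prems by auto
    then have "((\<lambda>x. f x + g x) has_derivative
        (\<lambda>h. frechet_derivative f (at x) h + frechet_derivative g (at x) h)) (at x)"
      by (intro has_derivative_add) (auto simp: frechet_derivative_works)
    from partial_deriv_eq[OF this]
    show "partial_deriv i (\<lambda>x. f x + g x) x = partial_deriv i f x + partial_deriv i g x"
      by (simp add: partial_deriv_def)
  qed
  then show ?case using Suc by (auto intro: differentiable_add)
qed

lemma partial_deriv_mult:
  assumes "f differentiable (at x)" "g differentiable (at x)"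
  shows "partial_deriv i (\<lambda>x. f x * g x) x = f x * partial_deriv i g x + partial_deriv i f x * g x"
proof -
  have "((\<lambda>x. f x * g x) has_derivative
      (\<lambda>h. f x * frechet_derivative g (at x) h + frechet_derivative f (at x) h * g x)) (at x)"
    using assms by (intro has_derivative_mult) (auto simp: frechet_derivative_works)
  from partial_deriv_eq[OF this] show ?thesis by (simp add: partial_deriv_def)
qed

lemma C_class_mult:
  "C_class k f \<Longrightarrow> C_class k g \<Longrightarrow> C_class k (\<lambda>x. f x * g x)"
proof (induction k arbitrary: f g)
  case 0
  then show ?case by (auto intro: continuous_intros)
next
  case (Suc k)
  have "partial_deriv i (\<lambda>x. f x * g x) = (\<lambda>x. f x * partial_deriv i g x + partial_deriv i f x * g x)" for i
    using Suc.prems by (auto intro!: ext partial_deriv_mult)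
  moreover have "C_class k f" "C_class k g" using Suc.prems C_class_SucD by blast+
  ultimately show ?case using Suc by (auto intro: differentiable_mult C_class_add)
qed

lemma C_class_prod:
  "finite A \<Longrightarrow> (\<And>i. i \<in> A \<Longrightarrow> C_class k (f i)) \<Longrightarrow> C_class k (\<lambda>x. \<Prod>i\<in>A. f i x)"
  by (induction A rule: finite_induct) (auto intro: C_class_const C_class_mult)

text \<open>The chain rule for \<open>x \<mapsto> b *\<^sub>R x\<close> is what makes the class of test functions invariant under
  dilations; weak gradients are later transported along dilations by moving the dilation onto the
  test function.\<close>

lemma has_derivative_scale:
  fixes f :: "real ^ 'n \<Rightarrow> real"
  assumes "f differentiable (at (b *\<^sub>R x))"
  shows "((\<lambda>x. f (b *\<^sub>R x)) has_derivative (\<lambda>h. b * frechet_derivative f (at (b *\<^sub>R x)) h)) (at x)"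
proof -
  let ?D = "frechet_derivative f (at (b *\<^sub>R x))"
  have D: "(f has_derivative ?D) (at (b *\<^sub>R x))"
    using assms frechet_derivative_works by blast
  have "((\<lambda>x. b *\<^sub>R x) has_derivative (\<lambda>h. b *\<^sub>R h)) (at x)"
    by (auto intro!: derivative_eq_intros)
  then have "((\<lambda>x. f (b *\<^sub>R x)) has_derivative (\<lambda>h. ?D (b *\<^sub>R h))) (at x)"
    using D by (rule has_derivative_compose)
  then show ?thesis
    by (simp add: linear_cmul[OF has_derivative_linear[OF D]])
qed

lemma partial_deriv_scale:
  assumes "f differentiable (at (b *\<^sub>R x))"
  shows "partial_deriv i (\<lambda>x. f (b *\<^sub>R x)) x = b * partial_deriv i f (b *\<^sub>R x)"
  using partial_deriv_eq[OF has_derivative_scale[OF assms]] by (simp add: partial_deriv_def)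

lemma C_class_scale: "C_class k f \<Longrightarrow> C_class k (\<lambda>x. f (b *\<^sub>R x))"
proof (induction k arbitrary: f)
  case 0
  then show ?case by (auto intro!: continuous_on_compose2[of UNIV f] continuous_intros)
next
  case (Suc k)
  have "(\<lambda>x. f (b *\<^sub>R x)) differentiable (at x)" for x
    using Suc.prems has_derivative_scale[of f b x] unfolding differentiable_def[of "\<lambda>x. f (b *\<^sub>R x)"]
    by auto
  moreover have "partial_deriv i (\<lambda>x. f (b *\<^sub>R x)) = (\<lambda>x. b * partial_deriv i f (b *\<^sub>R x))" for i
    using Suc.prems by (auto intro!: ext partial_deriv_scale)
  ultimately show ?case using Suc by (auto intro!: C_class_mult C_class_const)
qed

lemma partial_deriv_zero_off_support:
  assumes "x \<notin> closure {x. f x \<noteq> 0}"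
  shows "partial_deriv i f x = 0"
proof -
  have "(f has_derivative (\<lambda>h. 0)) (at x)"
  proof (rule has_derivative_transform_within_open[of "\<lambda>x. 0" _ _ _ "- closure {x. f x \<noteq> 0}"])
    show "\<And>y. y \<in> - closure {x. f x \<noteq> 0} \<Longrightarrow> 0 = f y"
      using closure_subset[of "{x. f x \<noteq> 0}"] by auto
  qed (use assms in auto)
  from partial_deriv_eq[OF this] show ?thesis .
qed

lemma test_functions_C: "f \<in> test_functions \<Longrightarrow> C_class k f"
  by (auto simp: test_functions_def)

lemma test_functions_diff: "f \<in> test_functions \<Longrightarrow> f differentiable (at x)"
  using test_functions_C[of f "Suc 0"] by auto

lemma test_functions_continuous: "f \<in> test_functions \<Longrightarrow> continuous_on UNIV f"
  using test_functions_C[of f 0] by auto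

lemma test_functionsI:
  assumes "\<And>k. C_class k f" "compact S" "\<And>x. x \<notin> S \<Longrightarrow> f x = 0"
  shows "f \<in> test_functions"
proof -
  have "closure {x. f x \<noteq> 0} \<subseteq> S"
    using assms by (intro closure_minimal) (auto intro: compact_imp_closed)
  then have "compact (closure {x. f x \<noteq> 0})"
    using assms(2) closed_closure compact_Int_closed by (metis inf.absorb_iff2)
  then show ?thesis using assms(1) by (simp add: test_functions_def)
qed

lemma test_functions_support:
  assumes "f \<in> test_functions"
  shows "\<exists>S. compact S \<and> (\<forall>x. x \<notin> S \<longrightarrow> f x = 0) \<and> (\<forall>i x. x \<notin> S \<longrightarrow> partial_deriv i f x = 0)"
proof (intro exI conjI allI impI)
  show "compact (closure {x. f x \<noteq> 0})" using assms by (simp add: test_functions_def)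
  show "f x = 0" if "x \<notin> closure {x. f x \<noteq> 0}" for x
    using that closure_subset[of "{x. f x \<noteq> 0}"] by blast
  show "partial_deriv i f x = 0" if "x \<notin> closure {x. f x \<noteq> 0}" for x i
    by (rule partial_deriv_zero_off_support[OF that])
qed

lemma test_functions_partial_deriv:
  assumes "f \<in> test_functions" shows "partial_deriv i f \<in> test_functions"
proof -
  obtain S where S: "compact S" "\<And>x. x \<notin> S \<Longrightarrow> partial_deriv i f x = 0"
    using test_functions_support[OF assms] by blast
  show ?thesis
    using test_functions_C[OF assms, of "Suc _"] by (intro test_functionsI[OF _ S]) auto
qed

lemma test_functions_mult:
  assumes "f \<in> test_functions" "g \<in> test_functions"
  shows "(\<lambda>x. f x * g x) \<in> test_functions"
proof -
  obtain S where "compact S" "\<And>x. x \<notin> S \<Longrightarrow> f x = 0"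
    using test_functions_support[OF assms(1)] by blast
  then show ?thesis using assms
    by (intro test_functionsI[of _ S]) (auto intro: C_class_mult test_functions_C)
qed

lemma test_functions_scale:
  assumes "f \<in> test_functions" "b \<noteq> 0"
  shows "(\<lambda>x. f (b *\<^sub>R x)) \<in> test_functions"
proof -
  obtain S where S: "compact S" "\<And>x. x \<notin> S \<Longrightarrow> f x = 0"
    using test_functions_support[OF assms(1)] by blast
  show ?thesis
  proof (rule test_functionsI)
    show "compact ((\<lambda>x. (1/b) *\<^sub>R x) ` S)" using S(1) by (rule compact_scaling)
    show "f (b *\<^sub>R x) = 0" if "x \<notin> (\<lambda>x. (1/b) *\<^sub>R x) ` S" for x
    proof (rule S(2))
      show "b *\<^sub>R x \<notin> S"
      proof
        assume "b *\<^sub>R x \<in> S"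
        then have "(1/b) *\<^sub>R (b *\<^sub>R x) \<in> (\<lambda>x. (1/b) *\<^sub>R x) ` S" by blast
        then show False using that assms(2) by simp
      qed
    qed
  qed (use assms in \<open>auto intro: C_class_scale test_functions_C\<close>)
qed

section \<open>Smooth bump functions\<close>

text \<open>For \<open>n = 0\<close> this is the classical smooth function that is flat at the origin. The powers of
  \<open>1 / t\<close> are included because the family is then closed under differentiation up to linear
  combinations, so that smoothness of all its members follows by one induction.\<close>

definition flat_exp :: "nat \<Rightarrow> real \<Rightarrow> real" where
  "flat_exp n t = (if t > 0 then exp (- (1 / t)) / t ^ n else 0)"

lemma flat_exp_nonzero: "flat_exp n t \<noteq> 0 \<longleftrightarrow> t > 0"
  by (simp add: flat_exp_def)

lemma flat_exp_tendsto_0: "(flat_exp n \<longlongrightarrow> 0) (at 0)"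
proof -
  have "((\<lambda>t. inverse t ^ n / exp (inverse t)) \<longlongrightarrow> 0) (at_right (0::real))"
    by (rule filterlim_compose[OF tendsto_power_div_exp_0 filterlim_inverse_at_top_right])
  moreover have "\<forall>\<^sub>F t in at_right 0. inverse t ^ n / exp (inverse t) = flat_exp n t"
    by (rule eventually_mono[OF eventually_at_right_less])
       (auto simp: flat_exp_def exp_minus field_simps)
  ultimately have "(flat_exp n \<longlongrightarrow> 0) (at_right 0)"
    using tendsto_cong by fastforce
  moreover have "(flat_exp n \<longlongrightarrow> 0) (at_left 0)"
    by (rule tendsto_eventually) (auto simp: flat_exp_def eventually_at_filter)
  ultimately show ?thesis using filterlim_split_at by blast
qed

text \<open>At the origin the difference quotient of \<open>flat_exp n\<close> is \<open>flat_exp (n + 1)\<close>, which tends to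
  zero; away from the origin this is ordinary calculus.\<close>

lemma flat_exp_has_derivative:
  "(flat_exp n has_real_derivative (flat_exp (n + 2) t - n * flat_exp (n + 1) t)) (at t)"
proof (cases t "0::real" rule: linorder_cases)
  case less
  have "((\<lambda>t. 0) has_real_derivative 0) (at t)" by simp
  then have "(flat_exp n has_real_derivative 0) (at t)"
    by (rule has_field_derivative_transform_within_open[of _ _ _ "{..<0}"])
       (use less in \<open>auto simp: flat_exp_def\<close>)
  then show ?thesis using less by (simp add: flat_exp_def)
next
  case equal
  have "((\<lambda>h. flat_exp n h / h) \<longlongrightarrow> 0) (at 0)"
    using flat_exp_tendsto_0[of "Suc n"]
    by (rule tendsto_cong[THEN iffD1, rotated])
       (auto simp: flat_exp_def eventually_at_filter)
  then show ?thesis using equal by (simp add: DERIV_def flat_exp_def)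
next
  case greater
  have "((\<lambda>t. exp (- (1 / t)) / t ^ n) has_real_derivative
      (exp (- (1 / t)) / t ^ (n + 2) - n * (exp (- (1 / t)) / t ^ (n + 1)))) (at t)"
  proof (cases n)
    case 0
    then show ?thesis using greater
      by (auto intro!: derivative_eq_intros simp: field_simps power2_eq_square)
  next
    case (Suc m)
    then show ?thesis using greater
      using power_eq_if[of t m]
      by (auto intro!: derivative_eq_intros simp: field_simps power2_eq_square)
  qed
  then have "(flat_exp n has_real_derivative
      (exp (- (1 / t)) / t ^ (n + 2) - n * (exp (- (1 / t)) / t ^ (n + 1)))) (at t)"
    by (rule has_field_derivative_transform_within_open[of _ _ _ "{0<..}"])
       (use greater in \<open>auto simp: flat_exp_def\<close>)
  then show ?thesis using greater by (simp add: flat_exp_def)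
qed

lemma C_class_flat_exp: "C_class k (\<lambda>x::real^'n. flat_exp n (c * x $ i + d))"
proof (induction k arbitrary: n)
  case 0
  have "continuous_on UNIV (flat_exp n)"
    by (rule DERIV_continuous_on[OF has_field_derivative_at_within[OF flat_exp_has_derivative]])
  then show ?case by (auto intro!: continuous_on_compose2[of UNIV "flat_exp n"] continuous_intros)
next
  case (Suc k)
  have D: "((\<lambda>x::real^'n. flat_exp n (c * x $ i + d)) has_derivative
     (\<lambda>h. (flat_exp (n + 2) (c * x $ i + d) - n * flat_exp (n + 1) (c * x $ i + d)) * (c * h $ i))) (at x)" for x
  proof -
    have "((\<lambda>x::real^'n. x $ i) has_derivative (\<lambda>h. h $ i)) (at x)"
      by (rule bounded_linear.has_derivative[OF bounded_linear_vec_nth has_derivative_ident])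
    then have "((\<lambda>x::real^'n. c * x $ i + d) has_derivative (\<lambda>h. c * h $ i)) (at x)"
      by (intro has_derivative_add_const has_derivative_mult_right)
    from has_derivative_compose[OF this flat_exp_has_derivative[of n "c * x $ i + d", unfolded has_field_derivative_def]]
    show ?thesis .
  qed
  have pd: "partial_deriv j (\<lambda>x::real^'n. flat_exp n (c * x $ i + d)) =
     (\<lambda>x. (flat_exp (n + 2) (c * x $ i + d) + (- n) * flat_exp (n + 1) (c * x $ i + d)) * (c * axis j 1 $ i))" for j
    by (rule ext, subst partial_deriv_eq[OF D]) auto
  have "C_class k (partial_deriv j (\<lambda>x::real^'n. flat_exp n (c * x $ i + d)))" for j
    unfolding pd by (intro C_class_mult C_class_add C_class_const Suc.IH)
  then show ?case using D by (auto simp: differentiable_def)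
qed

text \<open>A product of one-dimensional cut-offs, one for each face of the box. The parameter \<open>m\<close> makes
  them steeper: since \<open>flat_exp 0\<close> has limit one at infinity, the bumps converge to the indicator
  function of the open box.\<close>

definition bump :: "real ^ 'n \<Rightarrow> real ^ 'n \<Rightarrow> nat \<Rightarrow> real ^ 'n \<Rightarrow> real" where
  "bump a b m x =
     (\<Prod>i\<in>UNIV. flat_exp 0 (real (Suc m) * (x $ i - a $ i)) * flat_exp 0 (real (Suc m) * (b $ i - x $ i)))"

lemma bump_nonzero_iff: "bump a b m x \<noteq> 0 \<longleftrightarrow> x \<in> box a b"
proof -
  have "bump a b m x \<noteq> 0 \<longleftrightarrow>
      (\<forall>i. 0 < real (Suc m) * (x $ i - a $ i) \<and> 0 < real (Suc m) * (b $ i - x $ i))"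
    by (simp add: bump_def flat_exp_nonzero del: of_nat_Suc)
  then show ?thesis by (simp add: mem_box_cart zero_less_mult_iff del: of_nat_Suc)
qed

lemma bump_bounds: "0 \<le> bump a b m x" "bump a b m x \<le> 1"
proof -
  have "0 \<le> flat_exp 0 t \<and> flat_exp 0 t \<le> 1" for t by (auto simp: flat_exp_def)
  then show "0 \<le> bump a b m x" "bump a b m x \<le> 1"
    unfolding bump_def by (auto intro!: prod_nonneg prod_le_1 mult_le_one)
qed

lemma bump_test_function: "bump a b m \<in> test_functions"
proof (rule test_functionsI)
  show "C_class k (bump a b m)" for k
  proof -
    have eq: "bump a b m = (\<lambda>x. \<Prod>i\<in>UNIV. flat_exp 0 (real (Suc m) * x $ i + (- real (Suc m) * a $ i))
        * flat_exp 0 ((- real (Suc m)) * x $ i + real (Suc m) * b $ i))"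
      by (auto simp: bump_def algebra_simps fun_eq_iff)
    show ?thesis unfolding eq by (intro C_class_prod C_class_mult C_class_flat_exp) auto
  qed
  show "bump a b m x = 0" if "x \<notin> cbox a b" for x
    using that bump_nonzero_iff[of a b m x] box_subset_cbox by blast
qed auto

lemma bump_tendsto: "(\<lambda>m. bump a b m x) \<longlonglongrightarrow> indicator (box a b) x"
proof (cases "x \<in> box a b")
  case True
  have *: "(\<lambda>m. flat_exp 0 (real (Suc m) * t)) \<longlonglongrightarrow> 1" if "t > 0" for t
  proof -
    \<comment> \<open>Here \<open>flat_exp 0 ((m + 1) t) = exp (- 1 / ((m + 1) t))\<close>.\<close>
    have "(\<lambda>m. exp (- (inverse (real (Suc m)) * (1 / t)))) \<longlonglongrightarrow> exp (- (0 * (1 / t)))"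
      by (intro tendsto_intros LIMSEQ_inverse_real_of_nat)
    moreover have "exp (- (inverse (real (Suc m)) * (1 / t))) = flat_exp 0 (real (Suc m) * t)" for m
      using that by (simp add: flat_exp_def inverse_eq_divide zero_less_mult_iff del: of_nat_Suc)
    ultimately show ?thesis by simp
  qed
  have "(\<lambda>m. bump a b m x) \<longlonglongrightarrow> (\<Prod>i\<in>(UNIV::'a set). 1 * 1)"
    unfolding bump_def using True
    by (intro tendsto_prod tendsto_mult *) (auto simp: mem_box_cart)
  then show ?thesis using True by simp
next
  case False
  then show ?thesis using bump_nonzero_iff[of a b _ x] by auto
qed

section \<open>Square-integrable functions\<close>

lemma
  fixes f :: "'a::euclidean_space \<Rightarrow> 'b::{banach, second_countable_topology}"
  assumes [measurable]: "f \<in> borel_measurable borel" and b: "b \<noteq> 0"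
  shows lborel_integrable_scaleR_iff: "integrable lborel (\<lambda>x. f (b *\<^sub>R x)) \<longleftrightarrow> integrable lborel f"
    and lborel_integral_scaleR:
      "(LINT x|lborel. f (b *\<^sub>R x)) = (1 / \<bar>b\<bar> ^ DIM('a)) *\<^sub>R (LINT x|lborel. f x)"
proof -
  have eq: "lborel = density (distr lborel borel (\<lambda>x::'a. b *\<^sub>R x)) (\<lambda>_. ennreal (\<bar>b\<bar> ^ DIM('a)))"
    using lborel_affine[OF b, of 0] by simp
  have "integrable lborel f \<longleftrightarrow> integrable (distr lborel borel (\<lambda>x::'a. b *\<^sub>R x)) (\<lambda>x. (\<bar>b\<bar> ^ DIM('a)) *\<^sub>R f x)"
    by (subst eq, subst integrable_density) auto
  also have "\<dots> \<longleftrightarrow> integrable lborel (\<lambda>x. (\<bar>b\<bar> ^ DIM('a)) *\<^sub>R f (b *\<^sub>R x))"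
    by (subst integrable_distr_eq) auto
  also have "\<dots> \<longleftrightarrow> integrable lborel (\<lambda>x. f (b *\<^sub>R x))"
    using b integrable_scaleR_right[of "\<bar>b\<bar> ^ DIM('a)" lborel "\<lambda>x. f (b *\<^sub>R x)"]
      integrable_scaleR_right[of "1 / \<bar>b\<bar> ^ DIM('a)" lborel "\<lambda>x. (\<bar>b\<bar> ^ DIM('a)) *\<^sub>R f (b *\<^sub>R x)"]
    by auto
  finally show "integrable lborel (\<lambda>x. f (b *\<^sub>R x)) \<longleftrightarrow> integrable lborel f" by simp
  have "integral\<^sup>L lborel f = integral\<^sup>L (distr lborel borel (\<lambda>x::'a. b *\<^sub>R x)) (\<lambda>x. (\<bar>b\<bar> ^ DIM('a)) *\<^sub>R f x)"
    by (subst eq, subst integral_density) auto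
  also have "\<dots> = (LINT x|lborel. (\<bar>b\<bar> ^ DIM('a)) *\<^sub>R f (b *\<^sub>R x))"
    by (subst integral_distr) auto
  finally have "integral\<^sup>L lborel f = \<dots>" .
  then show "(LINT x|lborel. f (b *\<^sub>R x)) = (1 / \<bar>b\<bar> ^ DIM('a)) *\<^sub>R (LINT x|lborel. f x)"
    using b by simp
qed

text \<open>Working with squared norms throughout replaces the Minkowski inequality by the elementary bound \<open>norm_add_squared_le\<close>; the constant factor that
  this costs is harmless, since only convergence to zero is ever deduced from it.\<close>

definition L2sq :: "('a::euclidean_space \<Rightarrow> 'b::euclidean_space) \<Rightarrow> real" where
  "L2sq f = (LINT x|lborel. (norm (f x))\<^sup>2)"

lemma Lp_space_2_iff:
  "f \<in> Lp_space 2 \<longleftrightarrow> f \<in> borel_measurable borel \<and> integrable lborel (\<lambda>x. (norm (f x))\<^sup>2)"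
  by (simp add: Lp_space_def)

lemma Lp_norm_2_squared: "(Lp_norm 2 f)\<^sup>2 = L2sq f"
  by (simp add: Lp_norm_def L2sq_def powr_half_sqrt)

lemma L2sq_nonneg: "0 \<le> L2sq f"
  by (simp add: L2sq_def)

lemma L2sq_cong_AE:
  "f \<in> borel_measurable borel \<Longrightarrow> g \<in> borel_measurable borel \<Longrightarrow> AE x in lborel. f x = g x \<Longrightarrow> L2sq f = L2sq g"
  unfolding L2sq_def by (intro integral_cong_AE) auto

lemma norm_add_squared_le: "(norm (x + y))\<^sup>2 \<le> 2 * (norm x)\<^sup>2 + 2 * (norm (y::'a::real_normed_vector))\<^sup>2"
proof -
  have "(norm (x + y))\<^sup>2 \<le> (norm x + norm y)\<^sup>2"
    by (intro power_mono norm_triangle_ineq) auto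
  also have "\<dots> \<le> 2 * (norm x)\<^sup>2 + 2 * (norm y)\<^sup>2"
    using sum_squares_bound[of "norm x" "norm y"] by (simp add: power2_sum)
  finally show ?thesis .
qed

lemma
  fixes f g :: "'a::euclidean_space \<Rightarrow> 'b::euclidean_space"
  assumes f: "f \<in> Lp_space 2" and g: "g \<in> Lp_space 2"
  shows Lp_space_2_add: "(\<lambda>x. f x + g x) \<in> Lp_space 2"
    and L2sq_add_le: "L2sq (\<lambda>x. f x + g x) \<le> 2 * L2sq f + 2 * L2sq g"
proof -
  have [measurable]: "f \<in> borel_measurable borel" "g \<in> borel_measurable borel"
    and i: "integrable lborel (\<lambda>x. (norm (f x))\<^sup>2)" "integrable lborel (\<lambda>x. (norm (g x))\<^sup>2)"
    using f g by (auto simp: Lp_space_2_iff)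
  have i': "integrable lborel (\<lambda>x. 2 * (norm (f x))\<^sup>2 + 2 * (norm (g x))\<^sup>2)"
    using i by (intro Bochner_Integration.integrable_add integrable_mult_right)
  have j: "integrable lborel (\<lambda>x. (norm (f x + g x))\<^sup>2)"
    by (rule Bochner_Integration.integrable_bound[OF i'])
       (auto intro!: AE_I2 order_trans[OF norm_add_squared_le])
  then show "(\<lambda>x. f x + g x) \<in> Lp_space 2" by (simp add: Lp_space_2_iff)
  have "L2sq (\<lambda>x. f x + g x) \<le> (LINT x|lborel. 2 * (norm (f x))\<^sup>2 + 2 * (norm (g x))\<^sup>2)"
    unfolding L2sq_def by (intro integral_mono i' j norm_add_squared_le)
  also have "\<dots> = 2 * L2sq f + 2 * L2sq g"
    using i by (simp add: L2sq_def)
  finally show "L2sq (\<lambda>x. f x + g x) \<le> 2 * L2sq f + 2 * L2sq g" .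
qed

lemma
  fixes f :: "'a::euclidean_space \<Rightarrow> 'b::euclidean_space"
  assumes f: "f \<in> Lp_space 2" and b: "b \<noteq> 0"
  shows Lp_space_2_scale: "(\<lambda>x. a *\<^sub>R f (b *\<^sub>R x)) \<in> Lp_space 2"
    and L2sq_scale: "L2sq (\<lambda>x. a *\<^sub>R f (b *\<^sub>R x)) = a\<^sup>2 / \<bar>b\<bar> ^ DIM('a) * L2sq f"
proof -
  have [measurable]: "f \<in> borel_measurable borel"
    and i: "integrable lborel (\<lambda>x. (norm (f x))\<^sup>2)"
    using f by (auto simp: Lp_space_2_iff)
  have "integrable lborel (\<lambda>x. (norm (f (b *\<^sub>R x)))\<^sup>2)"
    using i b by (subst lborel_integrable_scaleR_iff[where f="\<lambda>x. (norm (f x))\<^sup>2"]) auto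
  then show "(\<lambda>x. a *\<^sub>R f (b *\<^sub>R x)) \<in> Lp_space 2"
    by (auto simp: Lp_space_2_iff power_mult_distrib)
  show "L2sq (\<lambda>x. a *\<^sub>R f (b *\<^sub>R x)) = a\<^sup>2 / \<bar>b\<bar> ^ DIM('a) * L2sq f"
    unfolding L2sq_def using lborel_integral_scaleR[of "\<lambda>x. (norm (f x))\<^sup>2" b] b
    by (simp add: power_mult_distrib)
qed

lemma Lp_space_2_scaleR: "f \<in> Lp_space 2 \<Longrightarrow> (\<lambda>x. a *\<^sub>R f x) \<in> Lp_space 2"
  using Lp_space_2_scale[of f 1 a] by simp

lemma Lp_space_2_diff: "f \<in> Lp_space 2 \<Longrightarrow> g \<in> Lp_space 2 \<Longrightarrow> (\<lambda>x. f x - g x) \<in> Lp_space 2"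
  using Lp_space_2_add[of f "\<lambda>x. (-1) *\<^sub>R g x"] Lp_space_2_scaleR[of g "-1"] by simp

lemma Lp_space_2_integrable_mult:
  fixes f g :: "'a::euclidean_space \<Rightarrow> real"
  assumes f: "f \<in> Lp_space 2" and g: "g \<in> Lp_space 2"
  shows "integrable lborel (\<lambda>x. f x * g x)"
proof -
  have [measurable]: "f \<in> borel_measurable borel" "g \<in> borel_measurable borel"
    and i: "integrable lborel (\<lambda>x. (norm (f x))\<^sup>2)" "integrable lborel (\<lambda>x. (norm (g x))\<^sup>2)"
    using f g by (auto simp: Lp_space_2_iff)
  show ?thesis
  proof (rule Bochner_Integration.integrable_bound)
    show "integrable lborel (\<lambda>x. (norm (f x))\<^sup>2 + (norm (g x))\<^sup>2)"
      using i by (rule Bochner_Integration.integrable_add)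
    show "AE x in lborel. norm (f x * g x) \<le> norm ((norm (f x))\<^sup>2 + (norm (g x))\<^sup>2)"
    proof (rule AE_I2)
      fix x
      have "2 * (\<bar>f x\<bar> * \<bar>g x\<bar>) \<le> \<bar>f x\<bar>\<^sup>2 + \<bar>g x\<bar>\<^sup>2"
        using sum_squares_bound[of "\<bar>f x\<bar>" "\<bar>g x\<bar>"] by simp
      moreover have "0 \<le> \<bar>f x\<bar> * \<bar>g x\<bar>" by simp
      ultimately have "\<bar>f x\<bar> * \<bar>g x\<bar> \<le> \<bar>f x\<bar>\<^sup>2 + \<bar>g x\<bar>\<^sup>2" by linarith
      then show "norm (f x * g x) \<le> norm ((norm (f x))\<^sup>2 + (norm (g x))\<^sup>2)"
        by (simp add: abs_mult)
    qed
  qed auto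
qed

lemma Lp_space_2_component: 
  fixes v :: "'a::euclidean_space \<Rightarrow> real ^ 'n"
  assumes "v \<in> Lp_space 2" shows "(\<lambda>x. v x $ i) \<in> Lp_space 2"
proof -
  have [measurable]: "v \<in> borel_measurable borel"
    and i: "integrable lborel (\<lambda>x. (norm (v x))\<^sup>2)"
    using assms by (auto simp: Lp_space_2_iff)
  have [measurable]: "(\<lambda>x. v x $ i) \<in> borel_measurable borel"
    by (intro measurable_compose[OF \<open>v \<in> borel_measurable borel\<close>] borel_measurable_continuous_onI continuous_intros)
  have *: "(norm (v x $ i))\<^sup>2 \<le> (norm (v x))\<^sup>2" for x
    by (intro power_mono) (auto intro: component_le_norm_cart)
  have "integrable lborel (\<lambda>x. (norm (v x $ i))\<^sup>2)"
    by (rule Bochner_Integration.integrable_bound[OF i])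
       (use * in \<open>auto intro!: AE_I2\<close>)
  then show ?thesis by (simp add: Lp_space_2_iff)
qed

lemma compact_support_integrable:
  fixes f :: "'a::euclidean_space \<Rightarrow> real"
  assumes "continuous_on UNIV f" "compact S" "\<And>x. x \<notin> S \<Longrightarrow> f x = 0"
  shows "integrable lborel f"
proof -
  have "integrable lborel (\<lambda>x. indicator S x *\<^sub>R f x)"
    using assms(2) continuous_on_subset[OF assms(1)] by (intro borel_integrable_compact) auto
  moreover have "(\<lambda>x. indicator S x *\<^sub>R f x) = f"
    using assms(3) by (auto simp: fun_eq_iff indicator_def)
  ultimately show ?thesis by simp
qed

lemma compact_support_Lp_2:
  fixes f :: "'a::euclidean_space \<Rightarrow> real"
  assumes "continuous_on UNIV f" "compact S" "\<And>x. x \<notin> S \<Longrightarrow> f x = 0"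
  shows "f \<in> Lp_space 2"
proof -
  have "integrable lborel (\<lambda>x. (norm (f x))\<^sup>2)"
    using assms by (intro compact_support_integrable[of _ S]) (auto intro!: continuous_intros)
  then show ?thesis using assms(1) by (simp add: Lp_space_2_iff borel_measurable_continuous_onI)
qed

lemma test_functions_Lp_2: "f \<in> test_functions \<Longrightarrow> f \<in> Lp_space 2"
  using test_functions_support[of f] test_functions_continuous[of f] compact_support_Lp_2[of f] by blast

lemma test_functions_integrable: "f \<in> test_functions \<Longrightarrow> integrable lborel f"
  using test_functions_support[of f] test_functions_continuous[of f] compact_support_integrable[of f] by blast

section \<open>The fundamental lemma of the calculus of variations\<close>

text \<open>Boxes are stable under intersection and generate the Borel sets, and, since the total
  integral vanishes as well, the sets over which the integral is zero form a Dynkin system. Hence the integral vanishes over every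
  Borel set, in particular over the sets where the function is positive or negative.\<close>

lemma AE_zero_of_box_integrals:
  fixes w :: "'a::euclidean_space \<Rightarrow> real"
  assumes w: "integrable lborel w" and box: "\<And>a b. (LINT x|lborel. indicator (box a b) x * w x) = 0"
    and all: "(LINT x|lborel. w x) = 0"
  shows "AE x in lborel. w x = 0"
proof -
  have set: "set_integrable lborel A w" if "A \<in> sets borel" for A
    unfolding set_integrable_def using w that by (intro integrable_mult_indicator) auto
  have *: "(\<integral>x\<in>A. w x \<partial>lborel) = 0" if "A \<in> sets borel" for A
  proof -
    have Int: "Int_stable (range (\<lambda>(a, b). box a b::'a set))"
      by (auto simp: Int_stable_def box_Int_box)
    have sub: "range (\<lambda>(a, b). box a b::'a set) \<subseteq> Pow UNIV" by simp
    have A: "A \<in> sigma_sets UNIV (range (\<lambda>(a, b). box a b::'a set))"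
      using that by (simp add: borel_eq_box)
    have sb: "X \<in> sets borel" if "X \<in> sigma_sets UNIV (range (\<lambda>(a, b). box a b::'a set))" for X
      using that by (simp add: borel_eq_box)
    show ?thesis using Int sub A
    proof (induction rule: sigma_sets_induct_disjoint)
      case (basic X)
      then show ?case using box by (auto simp: set_lebesgue_integral_def)
    next
      case empty
      then show ?case by (simp add: set_lebesgue_integral_def)
    next
      case (compl X)
      have "(\<integral>x\<in>UNIV. w x \<partial>lborel) = (\<integral>x\<in>X. w x \<partial>lborel) + (\<integral>x\<in>UNIV - X. w x \<partial>lborel)"
        using set_integral_Un[of X "UNIV - X" lborel w] set[OF sb[OF compl(1)]] set[of "UNIV - X"]
          sb[OF compl(1)] by (auto simp: Un_absorb1)
      then show ?case using compl all by (simp add: set_lebesgue_integral_def)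
    next
      case (union X)
      have X: "range X \<subseteq> sets lborel" using union(2) sb by auto
      then have "(\<Union>i. X i) \<in> sets borel" by auto
      then have "(\<integral>x\<in>(\<Union>i. X i). w x \<partial>lborel) = (\<Sum>i. (\<integral>x\<in>X i. w x \<partial>lborel))"
        using X union(1) set by (intro lebesgue_integral_countable_add) (auto simp: disjoint_family_on_def)
      then show ?case using union by simp
    qed
  qed
  show ?thesis
    using density_unique_real[OF w, of "\<lambda>x. 0"] * by (simp add: set_lebesgue_integral_def)
qed

text \<open>Testing with bumps and passing to the limit, the indicator function of a box, shows that the
  integral over every box vanishes. The function itself need not be integrable, so
  \<open>AE_zero_of_box_integrals\<close> is applied after restriction to boxes that exhaust the space.\<close>

lemma fundamental_lemma:
  fixes v :: "real ^ 'n \<Rightarrow> real"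
  assumes v: "v \<in> Lp_space 2"
    and test: "\<And>\<phi>. \<phi> \<in> test_functions \<Longrightarrow> (LINT x|lborel. v x * \<phi> x) = 0"
  shows "AE x in lborel. v x = 0"
proof -
  have [measurable]: "v \<in> borel_measurable borel" using v by (simp add: Lp_space_2_iff)
  have ind: "(indicator (box a b) :: real^'n \<Rightarrow> real) \<in> Lp_space 2" for a b
  proof -
    have "(\<lambda>x. (norm (indicator (box a b) x :: real))\<^sup>2) = indicator (box a b)"
      by (auto simp: indicator_def)
    then show ?thesis
      by (simp add: Lp_space_2_iff emeasure_lborel_box_eq)
  qed
  have int: "integrable lborel (\<lambda>x. indicator (box a b) x * v x)" for a b
    using Lp_space_2_integrable_mult[OF ind v] .
  have box: "(LINT x|lborel. indicator (box a b) x * v x) = 0" for a b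
  proof -
    have [measurable]: "bump a b m \<in> borel_measurable borel" for m
      using test_functions_continuous[OF bump_test_function] by (rule borel_measurable_continuous_onI)
    have "(\<lambda>m. LINT x|lborel. v x * bump a b m x) \<longlonglongrightarrow> (LINT x|lborel. indicator (box a b) x * v x)"
    proof (rule integral_dominated_convergence)
      show "integrable lborel (\<lambda>x. norm (indicator (box a b) x * v x))"
        using int by (rule integrable_norm)
      show "AE x in lborel. (\<lambda>m. v x * bump a b m x) \<longlonglongrightarrow> indicator (box a b) x * v x"
        using tendsto_mult[OF tendsto_const bump_tendsto] by (intro AE_I2) (simp add: mult.commute)
      show "AE x in lborel. norm (v x * bump a b m x) \<le> norm (indicator (box a b) x * v x)" for m
      proof (rule AE_I2)
        fix x
        show "norm (v x * bump a b m x) \<le> norm (indicator (box a b) x * v x)"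
          using bump_bounds[of a b m x] bump_nonzero_iff[of a b m x]
          by (cases "x \<in> box a b") (auto simp: abs_mult mult_left_le)
      qed
    qed auto
    moreover have "(\<lambda>m. LINT x|lborel. v x * bump a b m x) \<longlonglongrightarrow> 0"
      using test[OF bump_test_function] by simp
    ultimately show ?thesis by (rule LIMSEQ_unique)
  qed
  let ?B = "\<lambda>n::nat. box (- (real n *\<^sub>R One)) (real n *\<^sub>R One) :: (real^'n) set"
  have "AE x in lborel. indicator (?B n) x * v x = 0" for n
  proof (rule AE_zero_of_box_integrals[OF int _ box])
    fix a b :: "real ^ 'n"
    obtain c d where "box a b \<inter> ?B n = box c d" by (simp add: box_Int_box)
    then have "indicator (box c d) x = (indicator (box a b) x * indicator (?B n) x :: real)" for x
      using indicator_inter_arith[of "box a b" "?B n" x] by simp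
    then show "(LINT x|lborel. indicator (box a b) x * (indicator (?B n) x * v x)) = 0"
      using box[of c d] by (simp add: mult.assoc)
  qed
  then have "AE x in lborel. \<forall>n. indicator (?B n) x * v x = 0"
    unfolding AE_all_countable by blast
  then show ?thesis
  proof eventually_elim
    case (elim x)
    have "x \<in> (\<Union>n. ?B n)" using UN_box_eq_UNIV by blast
    then obtain n where "x \<in> ?B n" by blast
    then show ?case using elim[rule_format, of n] by simp
  qed
qed

section \<open>Continuity of dilations in the mean-square sense\<close>

text \<open>The two truncations together turn a function into a bounded one with bounded support, both
  continuously and without increasing its norm at any point. Continuity is needed since they are
  applied to a continuous approximation of the function as well as to the function itself.\<close>

definition cutoff :: "real \<Rightarrow> 'a::real_normed_vector \<Rightarrow> real" where
  "cutoff M x = max 0 (min 1 (M - norm x))"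

definition truncate :: "real \<Rightarrow> 'b::real_normed_vector \<Rightarrow> 'b" where
  "truncate M y = (M / max M (norm y)) *\<^sub>R y"

lemma cutoff_bounds: "0 \<le> cutoff M x" "cutoff M x \<le> 1"
  by (auto simp: cutoff_def)

lemma norm_truncate_le:
  assumes "M > 0"
  shows "norm (truncate M y) \<le> M" "norm (truncate M y) \<le> norm y"
proof -
  have m: "max M (norm y) > 0" "M \<le> max M (norm y)" "norm y \<le> max M (norm y)" using assms by auto
  have "norm (truncate M y) = M * norm y / max M (norm y)"
    using assms by (simp add: truncate_def)
  moreover have "M * norm y / max M (norm y) \<le> M"
    using m assms mult_left_mono[OF m(3), of M] by (simp only: pos_divide_le_eq)
  moreover have "M * norm y / max M (norm y) \<le> norm y"
    using m assms mult_right_mono[OF m(2), of "norm y"] by (simp only: pos_divide_le_eq mult.commute norm_ge_zero)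
  ultimately show "norm (truncate M y) \<le> M" "norm (truncate M y) \<le> norm y" by simp_all
qed

lemma continuous_on_cutoff: "continuous_on A (cutoff M)"
  unfolding cutoff_def by (intro continuous_intros)

lemma continuous_on_truncate: "M > 0 \<Longrightarrow> continuous_on A (truncate M)"
  unfolding truncate_def by (intro continuous_intros) auto

lemma norm_cutoff_truncate_le:
  assumes "M > 0"
  shows "norm (cutoff M x *\<^sub>R truncate M y) \<le> M * indicator (cball 0 M) x"
    and "norm (cutoff M x *\<^sub>R truncate M y) \<le> norm y"
proof -
  have "norm (cutoff M x *\<^sub>R truncate M y) \<le> 1 * norm (truncate M y)"
    using cutoff_bounds[of M x] by (simp add: mult_left_le_one_le)
  then have *: "norm (cutoff M x *\<^sub>R truncate M y) \<le> norm (truncate M y)" by simp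
  then show "norm (cutoff M x *\<^sub>R truncate M y) \<le> norm y"
    using norm_truncate_le(2)[OF assms, of y] by linarith
  show "norm (cutoff M x *\<^sub>R truncate M y) \<le> M * indicator (cball 0 M) x"
  proof (cases "x \<in> cball 0 M")
    case True
    then show ?thesis using * norm_truncate_le(1)[OF assms, of y] by simp
  next
    case False
    then have "cutoff M x = 0" by (simp add: cutoff_def)
    then show ?thesis using False by simp
  qed
qed

lemma norm_diff_squared_le:
  assumes "norm (x::'a::real_normed_vector) \<le> r" "norm y \<le> r"
  shows "(norm (x - y))\<^sup>2 \<le> 4 * r\<^sup>2"
proof -
  have "norm (x - y) \<le> 2 * r" using norm_triangle_ineq4[of x y] assms by linarith
  then have "(norm (x - y))\<^sup>2 \<le> (2 * r)\<^sup>2" by (intro power_mono) auto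
  then show ?thesis by (simp add: power_mult_distrib)
qed

lemma integrable_const_cball:
  "integrable lborel (\<lambda>x::'a::euclidean_space. r * indicator (cball 0 R) x :: real)"
  using emeasure_bounded_finite[of "cball 0 R :: 'a set"]
  by (intro integrable_mult_right integrable_real_indicator) auto

text \<open>A measurable function is an almost everywhere limit of continuous functions. Applying the same
  truncation to the function and to the continuous functions makes this limit dominated, and the
  truncation itself changes the function little when the level \<open>M\<close> is large.\<close>

lemma L2_approx_continuous:
  fixes f :: "'a::euclidean_space \<Rightarrow> 'b::euclidean_space"
  assumes f: "f \<in> Lp_space 2" and e: "e > 0"
  obtains g M where "continuous_on UNIV g" "\<And>x. norm (g x) \<le> M * indicator (cball 0 M) x"
    "M > 0" "g \<in> Lp_space 2" "L2sq (\<lambda>x. f x - g x) < e"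
proof -
  have [measurable]: "f \<in> borel_measurable borel"
    and i: "integrable lborel (\<lambda>x. (norm (f x))\<^sup>2)"
    using f by (auto simp: Lp_space_2_iff)
  define t where "t M x = cutoff M x *\<^sub>R truncate M (f x)" for M x
  have ct: "(\<lambda>x. cutoff M x *\<^sub>R truncate M (g x)) \<in> borel_measurable borel"
    if "M > 0" and g: "g \<in> borel_measurable borel" for M and g :: "'a \<Rightarrow> 'b"
    using that by (intro borel_measurable_scaleR measurable_compose[OF g]
        borel_measurable_continuous_onI continuous_on_cutoff continuous_on_truncate)
  have [measurable]: "t M \<in> borel_measurable borel" if "M > 0" for M
    unfolding t_def using that by (intro ct) auto
  then have [measurable]: "t (real (Suc n)) \<in> borel_measurable borel" for n
    by (metis of_nat_0_less_iff zero_less_Suc)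
  have "(\<lambda>n. LINT x|lborel. (norm (f x - t (real (Suc n)) x))\<^sup>2) \<longlonglongrightarrow> (LINT x::'a|lborel. 0)"
  proof (rule integral_dominated_convergence)
    show "integrable lborel (\<lambda>x. 4 * (norm (f x))\<^sup>2)" using i by simp
    show "AE x in lborel. (\<lambda>n. (norm (f x - t (real (Suc n)) x))\<^sup>2) \<longlonglongrightarrow> 0"
    proof (intro AE_I2 tendsto_eventually)
      fix x
      obtain n0 where n0: "norm x + 1 + norm (f x) < real n0" using reals_Archimedean2 by blast
      show "\<forall>\<^sub>F n in sequentially. (norm (f x - t (real (Suc n)) x))\<^sup>2 = 0"
        using eventually_ge_at_top[of n0]
      proof eventually_elim
        case (elim n)
        then have "norm x + 1 + norm (f x) < real (Suc n)" using n0 by simp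
        moreover have "0 \<le> norm x" "0 \<le> norm (f x)" by simp_all
        ultimately have a: "norm x + 1 \<le> real (Suc n)" "norm (f x) \<le> real (Suc n)" by linarith+
        then have "cutoff (real (Suc n)) x = 1" unfolding cutoff_def by linarith
        moreover have "truncate (real (Suc n)) (f x) = f x"
          using a(2) by (simp add: truncate_def max_absorb1 del: of_nat_Suc)
        ultimately show ?case by (simp add: t_def)
      qed
    qed
    show "AE x in lborel. norm ((norm (f x - t (real (Suc n)) x))\<^sup>2) \<le> 4 * (norm (f x))\<^sup>2" for n
    proof (rule AE_I2)
      fix x
      have "(norm (f x - t (real (Suc n)) x))\<^sup>2 \<le> 4 * (norm (f x))\<^sup>2"
        unfolding t_def by (intro norm_diff_squared_le norm_cutoff_truncate_le(2)) auto
      then show "norm ((norm (f x - t (real (Suc n)) x))\<^sup>2) \<le> 4 * (norm (f x))\<^sup>2" by simp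
    qed
  qed (auto simp del: of_nat_Suc)
  then have "\<forall>\<^sub>F n in sequentially. L2sq (\<lambda>x. f x - t (real (Suc n)) x) < e / 4"
    using e by (intro order_tendstoD(2)[of _ 0]) (auto simp: L2sq_def)
  then obtain n where n: "L2sq (\<lambda>x. f x - t (real (Suc n)) x) < e / 4"
    using eventually_happens by force
  define M where "M = real (Suc n)"
  have M: "M > 0" by (simp add: M_def)
  have "f measurable_on UNIV"
    by (intro lebesgue_measurable_imp_measurable_on) (auto intro: measurable_completion)
  then obtain N g where N: "negligible N" and g: "\<And>n. continuous_on UNIV (g n)"
    and lim: "\<And>x. x \<notin> N \<Longrightarrow> (\<lambda>n. g n x) \<longlonglongrightarrow> f x"
    unfolding measurable_on_def by auto
  have "AE x in lebesgue. x \<notin> N"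
    using N by (intro AE_not_in) (simp add: negligible_iff_null_sets)
  then have AE: "AE x in lborel. x \<notin> N" by (simp add: AE_completion_iff)
  define h where "h k x = cutoff M x *\<^sub>R truncate M (g k x)" for k x
  have h_cont: "continuous_on UNIV (h k)" for k
    unfolding h_def using M
    by (intro continuous_intros continuous_on_cutoff continuous_on_compose2[OF continuous_on_truncate g]) auto
  then have [measurable]: "h k \<in> borel_measurable borel" for k
    by (rule borel_measurable_continuous_onI)
  have "(\<lambda>k. LINT x|lborel. (norm (t M x - h k x))\<^sup>2) \<longlonglongrightarrow> (LINT x::'a|lborel. 0)"
  proof (rule integral_dominated_convergence)
    show "integrable lborel (\<lambda>x::'a. 4 * M\<^sup>2 * indicator (cball 0 M) x :: real)"
      by (rule integrable_const_cball)
    show "AE x in lborel. (\<lambda>k. (norm (t M x - h k x))\<^sup>2) \<longlonglongrightarrow> 0"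
      using AE
    proof eventually_elim
      case (elim x)
      have "(\<lambda>k. truncate M (g k x)) \<longlonglongrightarrow> truncate M (f x)"
        using continuous_on_truncate[OF M, of UNIV] lim[OF elim]
        by (rule continuous_on_tendsto_compose) auto
      then have "(\<lambda>k. (norm (t M x - h k x))\<^sup>2) \<longlonglongrightarrow> (norm (t M x - t M x))\<^sup>2"
        unfolding h_def by (intro tendsto_intros) (auto simp: t_def intro!: tendsto_intros)
      then show ?case by simp
    qed
    show "AE x in lborel. norm ((norm (t M x - h k x))\<^sup>2) \<le> 4 * M\<^sup>2 * indicator (cball 0 M) x" for k
    proof (rule AE_I2)
      fix x
      have "(norm (t M x - h k x))\<^sup>2 \<le> 4 * (M * indicator (cball 0 M) x)\<^sup>2"
        unfolding t_def h_def by (intro norm_diff_squared_le norm_cutoff_truncate_le(1) M)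
      then show "norm ((norm (t M x - h k x))\<^sup>2) \<le> 4 * M\<^sup>2 * indicator (cball 0 M) x"
        by (cases "x \<in> cball 0 M") auto
    qed
  qed (use M in auto)
  then have "\<forall>\<^sub>F k in sequentially. L2sq (\<lambda>x. t M x - h k x) < e / 4"
    using e by (intro order_tendstoD(2)[of _ 0]) (auto simp: L2sq_def)
  then obtain k where k: "L2sq (\<lambda>x. t M x - h k x) < e / 4"
    using eventually_happens by force
  have hL: "h k \<in> Lp_space 2"
  proof -
    have "integrable lborel (\<lambda>x. (norm (h k x))\<^sup>2)"
    proof (rule Bochner_Integration.integrable_bound[OF integrable_const_cball[of "M\<^sup>2" M]])
      show "AE x in lborel. norm ((norm (h k x))\<^sup>2) \<le> norm (M\<^sup>2 * indicator (cball 0 M) x :: real)"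
      proof (rule AE_I2)
        fix x
        have "(norm (h k x))\<^sup>2 \<le> (M * indicator (cball 0 M) x)\<^sup>2"
          unfolding h_def by (intro power_mono norm_cutoff_truncate_le(1) M) auto
        then show "norm ((norm (h k x))\<^sup>2) \<le> norm (M\<^sup>2 * indicator (cball 0 M) x :: real)"
          by (cases "x \<in> cball 0 M") auto
      qed
    qed simp
    then show ?thesis by (simp add: Lp_space_2_iff)
  qed
  have tL: "t M \<in> Lp_space 2"
  proof -
    have "(norm (t M x))\<^sup>2 \<le> (norm (f x))\<^sup>2" for x
      unfolding t_def by (intro power_mono norm_cutoff_truncate_le(2) M) auto
    then have "integrable lborel (\<lambda>x. (norm (t M x))\<^sup>2)"
      by (intro Bochner_Integration.integrable_bound[OF i]) (use M in auto)
    then show ?thesis using M by (simp add: Lp_space_2_iff)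
  qed
  have "L2sq (\<lambda>x. (f x - t M x) + (t M x - h k x)) \<le> 2 * L2sq (\<lambda>x. f x - t M x) + 2 * L2sq (\<lambda>x. t M x - h k x)"
    by (intro L2sq_add_le Lp_space_2_diff f tL hL)
  also have "\<dots> < e" using n k by (simp add: M_def)
  finally have "L2sq (\<lambda>x. f x - h k x) < e" by simp
  moreover have "norm (h k x) \<le> M * indicator (cball 0 M) x" for x
    unfolding h_def by (rule norm_cutoff_truncate_le(1)[OF M])
  ultimately show ?thesis using that[of "h k" M] h_cont hL M by blast
qed

text \<open>For a continuous function of bounded support the claim is dominated convergence. In general,
  such a function is subtracted; the remainder \<open>r\<close> is small, and rescaling multiplies its squared
  norm by the factor \<open>\<alpha>\<^sup>2 / \<beta> ^ d\<close>, which stays bounded because \<open>\<beta>\<close> stays away from zero.\<close>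

lemma L2_dilation_sequentially:
  fixes f :: "'a::euclidean_space \<Rightarrow> 'b::euclidean_space"
  assumes f: "f \<in> Lp_space 2" and a: "\<alpha> \<longlonglongrightarrow> a" and b: "\<beta> \<longlonglongrightarrow> b" and b0: "b > 0"
  shows "(\<lambda>n. L2sq (\<lambda>x. \<alpha> n *\<^sub>R f (\<beta> n *\<^sub>R x) - a *\<^sub>R f (b *\<^sub>R x))) \<longlonglongrightarrow> 0"
proof (rule order_tendstoI)
  fix e :: real assume "e < 0"
  then show "\<forall>\<^sub>F n in sequentially. e < L2sq (\<lambda>x. \<alpha> n *\<^sub>R f (\<beta> n *\<^sub>R x) - a *\<^sub>R f (b *\<^sub>R x))"
    using L2sq_nonneg by (auto intro!: always_eventually order_less_le_trans[OF \<open>e < 0\<close>])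
next
  fix e :: real assume e: "e > 0"
  \<comment> \<open>An eventual bound for the factor by which rescaling multiplies the squared norm of the remainder.\<close>
  define C where "C = a\<^sup>2 / b ^ DIM('a) + 1"
  have C: "C > 0" using b0 by (simp add: C_def add_nonneg_pos)
  obtain g M where g: "continuous_on UNIV g" "\<And>x. norm (g x) \<le> M * indicator (cball 0 M) x"
    "M > 0" "g \<in> Lp_space 2" "L2sq (\<lambda>x. f x - g x) < e / (12 * C)"
    using L2_approx_continuous[OF f, of "e / (12 * C)"] e C by auto
  have [measurable]: "g \<in> borel_measurable borel"
    using g(1) by (rule borel_measurable_continuous_onI)
  define r where "r x = f x - g x" for x
  have r: "r \<in> Lp_space 2" unfolding r_def by (intro Lp_space_2_diff f g(4))
  have "(\<lambda>n. (\<alpha> n)\<^sup>2 / (\<beta> n) ^ DIM('a)) \<longlonglongrightarrow> a\<^sup>2 / b ^ DIM('a)"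
    using b0 by (intro tendsto_intros a b) auto
  then have ev1: "\<forall>\<^sub>F n in sequentially. (\<alpha> n)\<^sup>2 / (\<beta> n) ^ DIM('a) < C"
    by (rule order_tendstoD(2)) (simp add: C_def)
  have ev2: "\<forall>\<^sub>F n in sequentially. b / 2 < \<beta> n"
    using b0 by (intro order_tendstoD(1)[OF b]) auto
  have ev3: "\<forall>\<^sub>F n in sequentially. \<bar>\<alpha> n\<bar> < \<bar>a\<bar> + 1"
    by (rule order_tendstoD(2)[OF tendsto_rabs[OF a]]) simp
  \<comment> \<open>The guard keeps the dominating function valid for all \<open>n\<close>, not only for large ones.\<close>
  define G where "G n x = (if b / 2 < \<beta> n \<and> \<bar>\<alpha> n\<bar> < \<bar>a\<bar> + 1 then \<alpha> n *\<^sub>R g (\<beta> n *\<^sub>R x) - a *\<^sub>R g (b *\<^sub>R x) else 0)" for n x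
  have "(\<lambda>n. LINT x|lborel. (norm (G n x))\<^sup>2) \<longlonglongrightarrow> (LINT x::'a|lborel. 0)"
  proof (rule integral_dominated_convergence)
    let ?R = "2 * M / b"
    show "integrable lborel (\<lambda>x::'a. (4 * ((\<bar>a\<bar> + 1) * M)\<^sup>2) * indicator (cball 0 ?R) x :: real)"
      by (rule integrable_const_cball)
    show "AE x in lborel. (\<lambda>n. (norm (G n x))\<^sup>2) \<longlonglongrightarrow> 0"
    proof (rule AE_I2)
      fix x
      have "(\<lambda>n. g (\<beta> n *\<^sub>R x)) \<longlonglongrightarrow> g (b *\<^sub>R x)"
        by (rule continuous_on_tendsto_compose[OF g(1)]) (auto intro!: tendsto_intros b)
      then have "(\<lambda>n. (norm (\<alpha> n *\<^sub>R g (\<beta> n *\<^sub>R x) - a *\<^sub>R g (b *\<^sub>R x)))\<^sup>2) \<longlonglongrightarrow> (norm (a *\<^sub>R g (b *\<^sub>R x) - a *\<^sub>R g (b *\<^sub>R x)))\<^sup>2"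
        by (intro tendsto_intros a)
      moreover have "\<forall>\<^sub>F n in sequentially. (norm (\<alpha> n *\<^sub>R g (\<beta> n *\<^sub>R x) - a *\<^sub>R g (b *\<^sub>R x)))\<^sup>2 = (norm (G n x))\<^sup>2"
        using ev2 ev3 by eventually_elim (simp add: G_def)
      ultimately show "(\<lambda>n. (norm (G n x))\<^sup>2) \<longlonglongrightarrow> 0"
        using tendsto_cong by force
    qed
    show "AE x in lborel. norm ((norm (G n x))\<^sup>2) \<le> (4 * ((\<bar>a\<bar> + 1) * M)\<^sup>2) * indicator (cball 0 ?R) x" for n
    proof (rule AE_I2)
      fix x
      show "norm ((norm (G n x))\<^sup>2) \<le> (4 * ((\<bar>a\<bar> + 1) * M)\<^sup>2) * indicator (cball 0 ?R) x"
      proof (cases "b / 2 < \<beta> n \<and> \<bar>\<alpha> n\<bar> < \<bar>a\<bar> + 1")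
        case True
        have bd: "norm (c *\<^sub>R g (d *\<^sub>R x)) \<le> (\<bar>a\<bar> + 1) * M * indicator (cball 0 ?R) x"
          if "\<bar>c\<bar> \<le> \<bar>a\<bar> + 1" "b / 2 < d" for c d
        proof (cases "x \<in> cball 0 ?R")
          case T: True
          have "norm (g (d *\<^sub>R x)) \<le> M"
            using g(2)[of "d *\<^sub>R x"] g(3) by (cases "d *\<^sub>R x \<in> cball 0 M") (simp_all del: mem_cball)
          then have "\<bar>c\<bar> * norm (g (d *\<^sub>R x)) \<le> (\<bar>a\<bar> + 1) * M"
            using that(1) by (intro mult_mono) auto
          then show ?thesis using T by simp
        next
          case False
          have "M = b / 2 * ?R" using b0 by simp
          also have "\<dots> < b / 2 * norm x" using False b0 by (intro mult_strict_left_mono) auto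
          also have "\<dots> \<le> d * norm x" using that(2) by (intro mult_right_mono) auto
          also have "\<dots> = norm (d *\<^sub>R x)" using that(2) b0 by simp
          finally have "g (d *\<^sub>R x) = 0" using g(2)[of "d *\<^sub>R x"] by (simp add: indicator_def)
          then show ?thesis using False by simp
        qed
        have "(norm (G n x))\<^sup>2 \<le> 4 * ((\<bar>a\<bar> + 1) * M * indicator (cball 0 ?R) x)\<^sup>2"
          unfolding G_def using True b0 bd by (simp del: norm_scaleR, intro norm_diff_squared_le bd) auto
        then show ?thesis by (cases "x \<in> cball 0 ?R") auto
      next
        case False
        then have "G n x = 0" by (simp only: G_def if_False)
        then show ?thesis by (simp del: mem_cball)
      qed
    qed
  qed (auto simp: G_def)
  then have "\<forall>\<^sub>F n in sequentially. L2sq (G n) < e / 12"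
    using e by (intro order_tendstoD(2)[of _ 0]) (auto simp: L2sq_def)
  with ev1 ev2 ev3 show "\<forall>\<^sub>F n in sequentially. L2sq (\<lambda>x. \<alpha> n *\<^sub>R f (\<beta> n *\<^sub>R x) - a *\<^sub>R f (b *\<^sub>R x)) < e"
  proof eventually_elim
    case (elim n)
    have G: "G n = (\<lambda>x. \<alpha> n *\<^sub>R g (\<beta> n *\<^sub>R x) - a *\<^sub>R g (b *\<^sub>R x))"
      using elim by (auto simp: G_def fun_eq_iff)
    have bn: "\<beta> n > 0" using elim b0 by linarith
    have GL: "G n \<in> Lp_space 2" unfolding G
      using bn b0 by (intro Lp_space_2_diff Lp_space_2_scale g(4)) auto
    have r1: "(\<lambda>x. \<alpha> n *\<^sub>R r (\<beta> n *\<^sub>R x)) \<in> Lp_space 2" "L2sq (\<lambda>x. \<alpha> n *\<^sub>R r (\<beta> n *\<^sub>R x)) = (\<alpha> n)\<^sup>2 / \<beta> n ^ DIM('a) * L2sq r"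
      using L2sq_scale[OF r, of "\<beta> n"] Lp_space_2_scale[OF r, of "\<beta> n"] bn by auto
    have r2: "(\<lambda>x. (- a) *\<^sub>R r (b *\<^sub>R x)) \<in> Lp_space 2" "L2sq (\<lambda>x. (- a) *\<^sub>R r (b *\<^sub>R x)) = a\<^sup>2 / b ^ DIM('a) * L2sq r"
      using L2sq_scale[OF r, of b "-a"] Lp_space_2_scale[OF r, of b "-a"] b0 by auto
    have Lr: "C * L2sq r < e / 12"
      using g(5) C by (simp add: r_def[abs_def] pos_less_divide_eq mult.commute mult.left_commute)
    have s1: "L2sq (\<lambda>x. \<alpha> n *\<^sub>R r (\<beta> n *\<^sub>R x)) \<le> C * L2sq r"
      unfolding r1 using elim L2sq_nonneg[of r] by (intro mult_right_mono) auto
    have s2: "L2sq (\<lambda>x. (- a) *\<^sub>R r (b *\<^sub>R x)) \<le> C * L2sq r"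
      unfolding r2 using L2sq_nonneg[of r] by (intro mult_right_mono) (auto simp: C_def)
    have "(\<lambda>x. \<alpha> n *\<^sub>R f (\<beta> n *\<^sub>R x) - a *\<^sub>R f (b *\<^sub>R x)) =
       (\<lambda>x. G n x + (\<alpha> n *\<^sub>R r (\<beta> n *\<^sub>R x) + (- a) *\<^sub>R r (b *\<^sub>R x)))"
      by (simp add: G r_def algebra_simps)
    then have "L2sq (\<lambda>x. \<alpha> n *\<^sub>R f (\<beta> n *\<^sub>R x) - a *\<^sub>R f (b *\<^sub>R x)) \<le>
        2 * L2sq (G n) + 2 * L2sq (\<lambda>x. \<alpha> n *\<^sub>R r (\<beta> n *\<^sub>R x) + (- a) *\<^sub>R r (b *\<^sub>R x))"
      using L2sq_add_le[OF GL Lp_space_2_add[OF r1(1) r2(1)]] by simp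
    moreover have "L2sq (\<lambda>x. \<alpha> n *\<^sub>R r (\<beta> n *\<^sub>R x) + (- a) *\<^sub>R r (b *\<^sub>R x)) \<le> 2 * (C * L2sq r) + 2 * (C * L2sq r)"
      using L2sq_add_le[OF r1(1) r2(1)] s1 s2 by linarith
    ultimately show ?case using elim(4) Lr e by linarith
  qed
qed

lemma L2_dilation_continuous:
  fixes f :: "'a::euclidean_space \<Rightarrow> 'b::euclidean_space" and t :: real
  assumes f: "f \<in> Lp_space 2" and a: "(\<alpha> \<longlongrightarrow> \<alpha> t) (at t within S)" and b: "(\<beta> \<longlongrightarrow> \<beta> t) (at t within S)"
    and b0: "\<beta> t > 0"
  shows "((\<lambda>s. L2sq (\<lambda>x. \<alpha> s *\<^sub>R f (\<beta> s *\<^sub>R x) - \<alpha> t *\<^sub>R f (\<beta> t *\<^sub>R x))) \<longlongrightarrow> 0) (at t within S)"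
  unfolding tendsto_at_iff_sequentially comp_def
proof (intro allI impI)
  fix X assume X: "\<forall>i. X i \<in> S - {t}" "X \<longlonglongrightarrow> t"
  have "(\<lambda>n. \<alpha> (X n)) \<longlonglongrightarrow> \<alpha> t" "(\<lambda>n. \<beta> (X n)) \<longlonglongrightarrow> \<beta> t"
    using a b X unfolding tendsto_at_iff_sequentially comp_def by blast+
  then show "(\<lambda>n. L2sq (\<lambda>x. \<alpha> (X n) *\<^sub>R f (\<beta> (X n) *\<^sub>R x) - \<alpha> t *\<^sub>R f (\<beta> t *\<^sub>R x))) \<longlonglongrightarrow> 0"
    using f b0 by (intro L2_dilation_sequentially)
qed

section \<open>Weak gradients\<close>

lemma H1_weak_grad:
  assumes "u \<in> H1"
  shows "u \<in> Lp_space 2" "weak_grad u \<in> Lp_space 2" "is_weak_gradient u (weak_grad u)"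
proof -
  show "u \<in> Lp_space 2" using assms by (simp add: H1_def)
  have "\<exists>v. v \<in> Lp_space 2 \<and> is_weak_gradient u v" using assms by (auto simp: H1_def)
  from someI_ex[OF this]
  show "weak_grad u \<in> Lp_space 2" "is_weak_gradient u (weak_grad u)"
    by (simp_all add: weak_grad_def)
qed

lemma H1I: "u \<in> Lp_space 2 \<Longrightarrow> v \<in> Lp_space 2 \<Longrightarrow> is_weak_gradient u v \<Longrightarrow> u \<in> H1"
  by (auto simp: H1_def)

text \<open>This makes the squared norm of \<open>weak_grad\<close> independent of the choice in its definition, so
  that it can be computed from any weak gradient that is at hand.\<close>

lemma weak_gradient_unique:
  assumes "is_weak_gradient u v" "is_weak_gradient u w" "v \<in> Lp_space 2" "w \<in> Lp_space 2"
  shows "AE x in lborel. v x = w x"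
proof -
  have "AE x in lborel. v x $ i - w x $ i = 0" for i
  proof (rule fundamental_lemma)
    show "(\<lambda>x. v x $ i - w x $ i) \<in> Lp_space 2"
      using assms by (intro Lp_space_2_diff Lp_space_2_component)
    fix \<phi> :: "real ^ 'a \<Rightarrow> real" assume \<phi>: "\<phi> \<in> test_functions"
    have "integrable lborel (\<lambda>x. v x $ i * \<phi> x)" "integrable lborel (\<lambda>x. w x $ i * \<phi> x)"
      using assms \<phi> by (intro Lp_space_2_integrable_mult Lp_space_2_component test_functions_Lp_2; simp)+
    moreover have "(LINT x|lborel. v x $ i * \<phi> x) = (LINT x|lborel. w x $ i * \<phi> x)"
      using assms(1,2) \<phi> by (simp add: is_weak_gradient_def)
    ultimately show "(LINT x|lborel. (v x $ i - w x $ i) * \<phi> x) = 0"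
      by (simp add: left_diff_distrib)
  qed
  then have "AE x in lborel. \<forall>i\<in>UNIV. v x $ i - w x $ i = 0"
    by (intro AE_finite_allI) auto
  then show ?thesis by eventually_elim (simp add: vec_eq_iff)
qed

lemma L2sq_weak_grad:
  assumes "u \<in> Lp_space 2" "v \<in> Lp_space 2" "is_weak_gradient u v"
  shows "L2sq (weak_grad u) = L2sq v"
proof -
  note w = H1_weak_grad[OF H1I[OF assms]]
  show ?thesis
    using weak_gradient_unique[OF w(3) assms(3) w(2) assms(2)] w(2) assms(2)
    by (intro L2sq_cong_AE) (auto simp: Lp_space_2_iff)
qed

lemma is_weak_gradient_diff:
  assumes "u \<in> Lp_space 2" "v \<in> Lp_space 2" "u' \<in> Lp_space 2" "v' \<in> Lp_space 2"
    and "is_weak_gradient u v" "is_weak_gradient u' v'"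
  shows "is_weak_gradient (\<lambda>x. u x - u' x) (\<lambda>x. v x - v' x)"
  unfolding is_weak_gradient_def
proof (intro ballI allI)
  fix \<phi> :: "real ^ 'a \<Rightarrow> real" and i assume \<phi>: "\<phi> \<in> test_functions"
  note L = test_functions_Lp_2[OF \<phi>] test_functions_Lp_2[OF test_functions_partial_deriv[OF \<phi>, of i]]
  have "integrable lborel (\<lambda>x. u x * partial_deriv i \<phi> x)" "integrable lborel (\<lambda>x. u' x * partial_deriv i \<phi> x)"
      "integrable lborel (\<lambda>x. v x $ i * \<phi> x)" "integrable lborel (\<lambda>x. v' x $ i * \<phi> x)"
    using assms by (intro Lp_space_2_integrable_mult Lp_space_2_component L; simp)+
  then show "(LINT x|lborel. (u x - u' x) * partial_deriv i \<phi> x) = - (LINT x|lborel. (v x - v' x) $ i * \<phi> x)"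
    using assms(5,6) \<phi> by (simp add: is_weak_gradient_def left_diff_distrib)
qed

text \<open>The substitution \<open>y = b x\<close> moves the dilation from \<open>u\<close> to the test function, and the same
  substitution backwards returns it to the gradient; the derivative contributes the factor \<open>b\<close>.\<close>

lemma is_weak_gradient_scale:
  fixes u :: "real ^ 'n \<Rightarrow> real"
  assumes u: "u \<in> Lp_space 2" and v: "v \<in> Lp_space 2" and uv: "is_weak_gradient u v" and b: "b > 0"
  shows "is_weak_gradient (\<lambda>x. a *\<^sub>R u (b *\<^sub>R x)) (\<lambda>x. (a * b) *\<^sub>R v (b *\<^sub>R x))"
  unfolding is_weak_gradient_def
proof (intro ballI allI)
  fix \<phi> :: "real ^ 'n \<Rightarrow> real" and i assume \<phi>: "\<phi> \<in> test_functions"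
  have [measurable]: "u \<in> borel_measurable borel" "(\<lambda>x. v x $ i) \<in> borel_measurable borel"
    using u Lp_space_2_component[OF v, of i] by (auto simp: Lp_space_2_iff)
  define \<psi> where "\<psi> = (\<lambda>x. \<phi> ((1 / b) *\<^sub>R x))"
  have \<psi>: "\<psi> \<in> test_functions" unfolding \<psi>_def using b by (intro test_functions_scale \<phi>) auto
  have [measurable]: "\<psi> \<in> borel_measurable borel" "partial_deriv i \<psi> \<in> borel_measurable borel"
    using \<psi> test_functions_partial_deriv[OF \<psi>] test_functions_continuous
    by (auto intro: borel_measurable_continuous_onI)
  have \<phi>\<psi>: "\<phi> x = \<psi> (b *\<^sub>R x)" for x using b by (simp add: \<psi>_def)
  then have "\<phi> = (\<lambda>x. \<psi> (b *\<^sub>R x))" by (simp add: fun_eq_iff)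
  then have pd: "partial_deriv i \<phi> x = b * partial_deriv i \<psi> (b *\<^sub>R x)" for x
    using partial_deriv_scale[OF test_functions_diff[OF \<psi>]] by simp
  let ?s = "1 / \<bar>b\<bar> ^ DIM(real ^ 'n)"
  have "(LINT x|lborel. a *\<^sub>R u (b *\<^sub>R x) * partial_deriv i \<phi> x)
      = (LINT x|lborel. a * b * (u (b *\<^sub>R x) * partial_deriv i \<psi> (b *\<^sub>R x)))"
    by (intro Bochner_Integration.integral_cong) (auto simp: pd)
  also have "\<dots> = a * b * ?s * (LINT x|lborel. u x * partial_deriv i \<psi> x)"
    using lborel_integral_scaleR[of "\<lambda>x. u x * partial_deriv i \<psi> x" b] b by simp
  also have "\<dots> = - (a * b * ?s * (LINT x|lborel. v x $ i * \<psi> x))"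
    using uv \<psi> by (simp add: is_weak_gradient_def)
  also have "\<dots> = - (LINT x|lborel. a * b * (v (b *\<^sub>R x) $ i * \<psi> (b *\<^sub>R x)))"
    using lborel_integral_scaleR[of "\<lambda>x. v x $ i * \<psi> x" b] b by simp
  also have "\<dots> = - (LINT x|lborel. ((a * b) *\<^sub>R v (b *\<^sub>R x)) $ i * \<phi> x)"
    by (simp add: \<phi>\<psi> mult.assoc)
  finally show "(LINT x|lborel. a *\<^sub>R u (b *\<^sub>R x) * partial_deriv i \<phi> x)
      = - (LINT x|lborel. ((a * b) *\<^sub>R v (b *\<^sub>R x)) $ i * \<phi> x)" .
qed

lemma H1_diff: 
  assumes "u \<in> H1" "u' \<in> H1"
  shows "(\<lambda>x. u x - u' x) \<in> H1"
    and "L2sq (weak_grad (\<lambda>x. u x - u' x)) = L2sq (\<lambda>x. weak_grad u x - weak_grad u' x)"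
proof -
  note w = H1_weak_grad[OF assms(1)] H1_weak_grad[OF assms(2)]
  have "is_weak_gradient (\<lambda>x. u x - u' x) (\<lambda>x. weak_grad u x - weak_grad u' x)"
    using w by (intro is_weak_gradient_diff)
  moreover have "(\<lambda>x. u x - u' x) \<in> Lp_space 2" "(\<lambda>x. weak_grad u x - weak_grad u' x) \<in> Lp_space 2"
    using w by (intro Lp_space_2_diff; simp)+
  ultimately show "(\<lambda>x. u x - u' x) \<in> H1"
    "L2sq (weak_grad (\<lambda>x. u x - u' x)) = L2sq (\<lambda>x. weak_grad u x - weak_grad u' x)"
    by (auto intro: H1I L2sq_weak_grad)
qed

lemma H1_scale: 
  fixes u :: "real ^ 'n \<Rightarrow> real"
  assumes "u \<in> H1" "b > 0"
  shows "(\<lambda>x. a *\<^sub>R u (b *\<^sub>R x)) \<in> H1"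
    and "L2sq (weak_grad (\<lambda>x. a *\<^sub>R u (b *\<^sub>R x))) = a\<^sup>2 * b\<^sup>2 / b ^ CARD('n) * L2sq (weak_grad u)"
    and "AE x in lborel. weak_grad (\<lambda>x. a *\<^sub>R u (b *\<^sub>R x)) x = (a * b) *\<^sub>R weak_grad u (b *\<^sub>R x)"
proof -
  note w = H1_weak_grad[OF assms(1)]
  have g: "is_weak_gradient (\<lambda>x. a *\<^sub>R u (b *\<^sub>R x)) (\<lambda>x. (a * b) *\<^sub>R weak_grad u (b *\<^sub>R x))"
    using w assms(2) by (intro is_weak_gradient_scale)
  have L: "(\<lambda>x. a *\<^sub>R u (b *\<^sub>R x)) \<in> Lp_space 2" "(\<lambda>x. (a * b) *\<^sub>R weak_grad u (b *\<^sub>R x)) \<in> Lp_space 2"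
    using w assms(2) by (intro Lp_space_2_scale; simp)+
  show H: "(\<lambda>x. a *\<^sub>R u (b *\<^sub>R x)) \<in> H1" using H1I[OF L g] .
  show "L2sq (weak_grad (\<lambda>x. a *\<^sub>R u (b *\<^sub>R x))) = a\<^sup>2 * b\<^sup>2 / b ^ CARD('n) * L2sq (weak_grad u)"
    using L2sq_weak_grad[OF L g] L2sq_scale[OF w(2), of b "a * b"] assms(2)
    by (simp add: power_mult_distrib)
  show "AE x in lborel. weak_grad (\<lambda>x. a *\<^sub>R u (b *\<^sub>R x)) x = (a * b) *\<^sub>R weak_grad u (b *\<^sub>R x)"
    using H1_weak_grad(2,3)[OF H] g L(2) by (intro weak_gradient_unique)
qed

section \<open>Integration by parts for test functions\<close>

lemma lborel_integral_translate:
  fixes f :: "'a::euclidean_space \<Rightarrow> real"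
  assumes [measurable]: "f \<in> borel_measurable borel"
  shows "(LINT x|lborel. f (c + x)) = (LINT x|lborel. f x)"
    and "integrable lborel (\<lambda>x. f (c + x)) \<longleftrightarrow> integrable lborel f"
proof -
  have "integral\<^sup>L (distr lborel borel ((+) c)) f = (LINT x|lborel. f (c + x))"
    by (rule integral_distr) auto
  then show "(LINT x|lborel. f (c + x)) = (LINT x|lborel. f x)"
    by (simp add: lborel_distr_plus)
  have "integrable (distr lborel borel ((+) c)) f \<longleftrightarrow> integrable lborel (\<lambda>x. f (c + x))"
    by (rule integrable_distr_eq) auto
  then show "integrable lborel (\<lambda>x. f (c + x)) \<longleftrightarrow> integrable lborel f"
    by (simp add: lborel_distr_plus)
qed

lemma partial_deriv_line:
  fixes f :: "real ^ 'n \<Rightarrow> real"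
  assumes "f differentiable (at (t *\<^sub>R axis i 1 + x))"
  shows "((\<lambda>t. f (t *\<^sub>R axis i 1 + x)) has_real_derivative partial_deriv i f (t *\<^sub>R axis i 1 + x)) (at t)"
proof -
  let ?D = "frechet_derivative f (at (t *\<^sub>R axis i 1 + x))"
  have D: "(f has_derivative ?D) (at (t *\<^sub>R axis i 1 + x))"
    using assms frechet_derivative_works by blast
  have "((\<lambda>t. t *\<^sub>R axis i 1 + x) has_derivative (\<lambda>h. h *\<^sub>R axis i 1)) (at t)"
    by (auto intro!: derivative_eq_intros)
  then have "((\<lambda>t. f (t *\<^sub>R axis i 1 + x)) has_derivative (\<lambda>h. ?D (h *\<^sub>R axis i 1))) (at t)"
    using D by (rule has_derivative_compose)
  then show ?thesis
    by (simp add: has_field_derivative_def partial_deriv_def linear_cmul[OF has_derivative_linear[OF D]] mult_commute_abs)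
qed

text \<open>By translation invariance the integral of every difference quotient vanishes. The quotients
  converge to the partial derivative, and by the mean value theorem they are bounded by the maximum
  of its absolute value and supported in a fixed ball, so that dominated convergence applies.\<close>

lemma integral_partial_deriv_zero:
  assumes f: "f \<in> test_functions"
  shows "(LINT x|lborel. partial_deriv i f x) = 0"
proof -
  define e :: "real ^ 'a" where "e = axis i 1"
  obtain S where S: "compact S" "\<And>x. x \<notin> S \<Longrightarrow> f x = 0" "\<And>x. x \<notin> S \<Longrightarrow> partial_deriv i f x = 0"
    using test_functions_support[OF f] by blast
  obtain R where R: "\<And>x. x \<in> S \<Longrightarrow> norm x \<le> R"
    using compact_imp_bounded[OF S(1)] by (auto simp: bounded_iff)
  have c: "continuous_on UNIV (partial_deriv i f)" "continuous_on UNIV f"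
    using f test_functions_partial_deriv test_functions_continuous by blast+
  have [measurable]: "f \<in> borel_measurable borel" "partial_deriv i f \<in> borel_measurable borel"
    using c by (auto intro: borel_measurable_continuous_onI)
  have "compact (partial_deriv i f ` S)"
    using S(1) continuous_on_subset[OF c(1)] by (intro compact_continuous_image) auto
  then obtain B where B: "\<And>x. x \<in> S \<Longrightarrow> \<bar>partial_deriv i f x\<bar> \<le> B"
    using compact_imp_bounded by (force simp: bounded_iff)
  have B': "\<bar>partial_deriv i f x\<bar> \<le> max B 0" for x
    using B[of x] S(3)[of x] by (cases "x \<in> S") auto
  define q where "q n x = real (Suc n) * (f ((1 / real (Suc n)) *\<^sub>R e + x) - f x)" for n x
  have q_mvt: "\<exists>s. 0 < s \<and> s < 1 / real (Suc n) \<and> q n x = partial_deriv i f (s *\<^sub>R e + x)" for n x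
  proof -
    have "\<exists>s. 0 < s \<and> s < 1 / real (Suc n) \<and>
       f ((1 / real (Suc n)) *\<^sub>R e + x) - f (0 *\<^sub>R e + x) = (1 / real (Suc n) - 0) * partial_deriv i f (s *\<^sub>R e + x)"
      by (rule MVT2[of 0 "1 / real (Suc n)" "\<lambda>t. f (t *\<^sub>R e + x)"])
         (auto simp: e_def intro!: partial_deriv_line test_functions_diff f)
    then show ?thesis by (auto simp: q_def simp del: of_nat_Suc)
  qed
  have "(\<lambda>n. LINT x|lborel. q n x) \<longlonglongrightarrow> (LINT x|lborel. partial_deriv i f x)"
  proof (rule integral_dominated_convergence)
    show "integrable lborel (\<lambda>x::real^'a. max B 0 * indicator (cball 0 (R + 1)) x)"
      by (rule integrable_const_cball)
    show "AE x in lborel. (\<lambda>n. q n x) \<longlonglongrightarrow> partial_deriv i f x"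
    proof (rule AE_I2)
      fix x
      have "((\<lambda>h. (f ((0 + h) *\<^sub>R e + x) - f (0 *\<^sub>R e + x)) / h) \<longlongrightarrow> partial_deriv i f (0 *\<^sub>R e + x)) (at 0)"
        using partial_deriv_line[OF test_functions_diff[OF f], where t=0 and i=i and x=x] unfolding DERIV_def e_def .
      moreover have "filterlim (\<lambda>n. 1 / real (Suc n)) (at 0) sequentially"
        unfolding filterlim_at using LIMSEQ_inverse_real_of_nat by (auto simp: inverse_eq_divide)
      ultimately have "(\<lambda>n. (f ((0 + 1 / real (Suc n)) *\<^sub>R e + x) - f (0 *\<^sub>R e + x)) / (1 / real (Suc n)))
          \<longlonglongrightarrow> partial_deriv i f (0 *\<^sub>R e + x)"
        by (rule filterlim_compose)
      then show "(\<lambda>n. q n x) \<longlonglongrightarrow> partial_deriv i f x"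
        by (simp add: q_def mult.commute del: of_nat_Suc)
    qed
    show "AE x in lborel. norm (q n x) \<le> max B 0 * indicator (cball 0 (R + 1)) x" for n
    proof (rule AE_I2)
      fix x
      obtain s where s: "0 < s" "s < 1 / real (Suc n)" "q n x = partial_deriv i f (s *\<^sub>R e + x)"
        using q_mvt by blast
      show "norm (q n x) \<le> max B 0 * indicator (cball 0 (R + 1)) x"
      proof (cases "x \<in> cball 0 (R + 1)")
        case True
        then show ?thesis using B' s(3) by simp
      next
        case False
        have "1 / real (Suc n) \<le> 1" by simp
        then have "s \<le> 1" using s(2) by linarith
        then have "norm (s *\<^sub>R e) \<le> 1" using s(1) by (simp add: e_def)
        then have "norm x \<le> norm (s *\<^sub>R e + x) + 1"
          using norm_triangle_ineq4[of "s *\<^sub>R e + x" "s *\<^sub>R e"] by simp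
        then have "s *\<^sub>R e + x \<notin> S" using R False by fastforce
        then show ?thesis using S(3) s(3) False by simp
      qed
    qed
  qed (auto simp: q_def)
  moreover have "(LINT x|lborel. q n x) = 0" for n
    using lborel_integral_translate[of f "(1 / real (Suc n)) *\<^sub>R e"] test_functions_integrable[OF f]
    by (simp add: q_def del: of_nat_Suc)
  ultimately show ?thesis by (simp add: LIMSEQ_const_iff)
qed

lemma test_function_weak_gradient:
  assumes f: "f \<in> test_functions"
  shows "is_weak_gradient f (\<lambda>x. \<chi> i. partial_deriv i f x)"
  unfolding is_weak_gradient_def
proof (intro ballI allI)
  fix \<phi> :: "real ^ 'a \<Rightarrow> real" and i assume \<phi>: "\<phi> \<in> test_functions"
  have i: "integrable lborel (\<lambda>x. f x * partial_deriv i \<phi> x)" "integrable lborel (\<lambda>x. partial_deriv i f x * \<phi> x)"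
    using f \<phi> test_functions_partial_deriv test_functions_Lp_2 by (intro Lp_space_2_integrable_mult; blast)+
  have "partial_deriv i (\<lambda>x. f x * \<phi> x) x = f x * partial_deriv i \<phi> x + partial_deriv i f x * \<phi> x" for x
    by (intro partial_deriv_mult test_functions_diff f \<phi>)
  then have "(LINT x|lborel. f x * partial_deriv i \<phi> x + partial_deriv i f x * \<phi> x) = 0"
    using integral_partial_deriv_zero[OF test_functions_mult[OF f \<phi>], of i] by simp
  then show "(LINT x|lborel. f x * partial_deriv i \<phi> x) = - (LINT x|lborel. (\<chi> i. partial_deriv i f x) $ i * \<phi> x)"
    using i by simp
qed

lemma test_functions_H1:
  assumes f: "f \<in> test_functions" shows "f \<in> H1"
proof (rule H1I)
  obtain S where S: "compact S" "\<And>i x. x \<notin> S \<Longrightarrow> partial_deriv i f x = 0"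
    using test_functions_support[OF f] by blast
  have c: "continuous_on UNIV (\<lambda>x. \<chi> i. partial_deriv i f x)"
    using f test_functions_partial_deriv test_functions_continuous
    by (intro continuous_on_vec_lambda) blast
  have "integrable lborel (\<lambda>x. (norm (\<chi> i. partial_deriv i f x))\<^sup>2)"
  proof (rule compact_support_integrable[OF _ S(1)])
    show "(norm (\<chi> i. partial_deriv i f x))\<^sup>2 = 0" if "x \<notin> S" for x
      using S(2)[OF that] by (simp add: vec_eq_iff)
  qed (intro continuous_intros c)
  then show "(\<lambda>x. \<chi> i. partial_deriv i f x) \<in> Lp_space 2"
    using c by (simp add: Lp_space_2_iff borel_measurable_continuous_onI)
qed (use f in \<open>auto intro: test_functions_Lp_2 test_function_weak_gradient\<close>)

section \<open>Rescaling in $H^1$\<close>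

text \<open>The energy is \<open>grad_sq u / 2 - Lp_power p u / p\<close>. These two quantities and the mass
  \<open>L2sq\<close> are homogeneous under rescaling, which reduces the behaviour of the energy along a dilation
  to calculus in one variable.\<close>

definition grad_sq :: "(real ^ 'n \<Rightarrow> real) \<Rightarrow> real" where
  "grad_sq u = L2sq (weak_grad u)"

definition Lp_power :: "real \<Rightarrow> (real ^ 'n \<Rightarrow> real) \<Rightarrow> real" where
  "Lp_power p u = (LINT x|lborel. norm (u x) powr p)"

definition rescale :: "real \<Rightarrow> real \<Rightarrow> (real ^ 'n \<Rightarrow> real) \<Rightarrow> real ^ 'n \<Rightarrow> real" where
  "rescale a b u = (\<lambda>x. a * u (b *\<^sub>R x))"

lemma Lp_power_nonneg: "0 \<le> Lp_power p u" by (simp add: Lp_power_def)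

lemma grad_sq_nonneg: "0 \<le> grad_sq u" by (simp add: grad_sq_def L2sq_nonneg)

lemma energy_eq: "p > 0 \<Longrightarrow> energy p u = grad_sq u / 2 - Lp_power p u / p"
  unfolding energy_def Lp_norm_2_squared grad_sq_def Lp_power_def
  by (simp add: Lp_norm_def powr_powr)

lemma mass_sphere_iff: "u \<in> mass_sphere c \<longleftrightarrow> u \<in> H1 \<and> L2sq u = c"
  by (simp add: mass_sphere_def Lp_norm_2_squared)

lemma small_grad_set_iff: "u \<in> small_grad_set K c \<longleftrightarrow> u \<in> mass_sphere c \<and> grad_sq u \<le> K"
  by (simp add: small_grad_set_def Lp_norm_2_squared grad_sq_def)

lemma H1_norm_eq: "H1_norm u = sqrt (L2sq u + grad_sq u)"
  by (simp add: H1_norm_def Lp_norm_2_squared grad_sq_def)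

text \<open>Paths in $H^1$ are continuous precisely if the function and its gradient vary continuously
  in the mean-square sense, and the two can be treated separately.\<close>

lemma H1_norm_tendsto_0_iff:
  "((\<lambda>s. H1_norm (w s)) \<longlongrightarrow> 0) F \<longleftrightarrow>
    ((\<lambda>s. L2sq (w s)) \<longlongrightarrow> 0) F \<and> ((\<lambda>s. grad_sq (w s)) \<longlongrightarrow> 0) F"
proof safe
  assume "((\<lambda>s. H1_norm (w s)) \<longlongrightarrow> 0) F"
  then have "((\<lambda>s. (H1_norm (w s))\<^sup>2) \<longlongrightarrow> 0\<^sup>2) F" by (rule tendsto_power)
  then have *: "((\<lambda>s. L2sq (w s) + grad_sq (w s)) \<longlongrightarrow> 0) F"
    by (simp add: H1_norm_eq L2sq_nonneg grad_sq_nonneg)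
  show "((\<lambda>s. L2sq (w s)) \<longlongrightarrow> 0) F" "((\<lambda>s. grad_sq (w s)) \<longlongrightarrow> 0) F"
    by (rule tendsto_sandwich[OF _ _ tendsto_const *]; simp add: L2sq_nonneg grad_sq_nonneg)+
next
  assume "((\<lambda>s. L2sq (w s)) \<longlongrightarrow> 0) F" "((\<lambda>s. grad_sq (w s)) \<longlongrightarrow> 0) F"
  then have "((\<lambda>s. sqrt (L2sq (w s) + grad_sq (w s))) \<longlongrightarrow> sqrt (0 + 0)) F"
    by (intro tendsto_intros)
  then show "((\<lambda>s. H1_norm (w s)) \<longlongrightarrow> 0) F" by (simp add: H1_norm_eq)
qed

lemma
  fixes u :: "real ^ 'n \<Rightarrow> real"
  assumes "u \<in> H1" "b > 0"
  shows rescale_H1: "rescale a b u \<in> H1"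
    and L2sq_rescale: "L2sq (rescale a b u) = a\<^sup>2 / b ^ CARD('n) * L2sq u"
    and grad_sq_rescale: "grad_sq (rescale a b u) = a\<^sup>2 * b\<^sup>2 / b ^ CARD('n) * grad_sq u"
    and Lp_power_rescale: "Lp_power p (rescale a b u) = \<bar>a\<bar> powr p / b ^ CARD('n) * Lp_power p u"
proof -
  have [measurable]: "u \<in> borel_measurable borel" using H1_weak_grad(1)[OF assms(1)] by (simp add: Lp_space_2_iff)
  show "rescale a b u \<in> H1" "grad_sq (rescale a b u) = a\<^sup>2 * b\<^sup>2 / b ^ CARD('n) * grad_sq u"
    using H1_scale(1,2)[OF assms, of a] by (simp_all add: rescale_def grad_sq_def)
  show "L2sq (rescale a b u) = a\<^sup>2 / b ^ CARD('n) * L2sq u"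
    using L2sq_scale[OF H1_weak_grad(1)[OF assms(1)], of b a] assms(2) by (simp add: rescale_def)
  show "Lp_power p (rescale a b u) = \<bar>a\<bar> powr p / b ^ CARD('n) * Lp_power p u"
    unfolding Lp_power_def rescale_def using lborel_integral_scaleR[of "\<lambda>x. norm (u x) powr p" b] assms(2)
    by (simp add: abs_mult powr_mult)
qed

section \<open>Paths in $H^1$\<close>

lemma continuous_H1_path_rescale:
  fixes g :: "real \<Rightarrow> real ^ 'n \<Rightarrow> real"
  assumes g: "continuous_H1_path g" and H: "\<And>t. t \<in> {0..1} \<Longrightarrow> g t \<in> H1" and b: "b > 0"
  shows "continuous_H1_path (\<lambda>t. rescale a b (g t))"
  unfolding continuous_H1_path_def
proof
  fix t :: real assume t: "t \<in> {0..1}"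
  let ?w = "\<lambda>s x. g s x - g t x"
  have eq: "(\<lambda>x. rescale a b (g s) x - rescale a b (g t) x) = rescale a b (?w s)" for s
    by (simp add: rescale_def right_diff_distrib)
  have wH: "?w s \<in> H1" if "s \<in> {0..1}" for s using H1_diff(1) H that t by blast
  have "((\<lambda>s. H1_norm (?w s)) \<longlongrightarrow> 0) (at t within {0..1})"
    using g t by (simp add: continuous_H1_path_def)
  then have w: "((\<lambda>s. L2sq (?w s)) \<longlongrightarrow> 0) (at t within {0..1})" "((\<lambda>s. grad_sq (?w s)) \<longlongrightarrow> 0) (at t within {0..1})"
    by (simp_all add: H1_norm_tendsto_0_iff)
  have ev: "\<forall>\<^sub>F s in at t within {0..1}. s \<in> {0..1}" by (simp add: eventually_at_filter)
  have lim: "((\<lambda>s. a\<^sup>2 / b ^ CARD('n) * L2sq (?w s)) \<longlongrightarrow> 0) (at t within {0..1})"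
      "((\<lambda>s. a\<^sup>2 * b\<^sup>2 / b ^ CARD('n) * grad_sq (?w s)) \<longlongrightarrow> 0) (at t within {0..1})"
    by (rule tendsto_mult_right_zero[OF w(1)]) (rule tendsto_mult_right_zero[OF w(2)])
  have "\<forall>\<^sub>F s in at t within {0..1}. a\<^sup>2 / b ^ CARD('n) * L2sq (?w s) = L2sq (rescale a b (?w s))"
    using ev by eventually_elim (simp add: L2sq_rescale wH b)
  with lim(1) have "((\<lambda>s. L2sq (rescale a b (?w s))) \<longlongrightarrow> 0) (at t within {0..1})"
    by (rule Lim_transform_eventually)
  moreover have "\<forall>\<^sub>F s in at t within {0..1}. a\<^sup>2 * b\<^sup>2 / b ^ CARD('n) * grad_sq (?w s) = grad_sq (rescale a b (?w s))"
    using ev by eventually_elim (simp add: grad_sq_rescale wH b)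
  with lim(2) have "((\<lambda>s. grad_sq (rescale a b (?w s))) \<longlongrightarrow> 0) (at t within {0..1})"
    by (rule Lim_transform_eventually)
  ultimately have "((\<lambda>s. L2sq (rescale a b (?w s))) \<longlongrightarrow> 0) (at t within {0..1})"
    "((\<lambda>s. grad_sq (rescale a b (?w s))) \<longlongrightarrow> 0) (at t within {0..1})" .
  then show "((\<lambda>s. H1_norm (\<lambda>x. rescale a b (g s) x - rescale a b (g t) x)) \<longlongrightarrow> 0) (at t within {0..1})"
    unfolding eq H1_norm_tendsto_0_iff ..
qed

text \<open>The dilation that preserves the mass. Along it the energy is the function
  \<open>\<alpha> * t\<^sup>2 - \<beta> * t powr \<sigma>\<close> of one variable, called the fibre map below.\<close>

definition dilate :: "real \<Rightarrow> (real ^ 'n \<Rightarrow> real) \<Rightarrow> real ^ 'n \<Rightarrow> real" where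
  "dilate t = rescale (t powr (real CARD('n) / 2)) t"

lemma dilate_1 [simp]: "dilate 1 u = u"
  by (simp add: dilate_def rescale_def)

lemma
  fixes u :: "real ^ 'n \<Rightarrow> real"
  assumes u: "u \<in> H1" and t: "t > 0"
  shows dilate_H1: "dilate t u \<in> H1"
    and L2sq_dilate: "L2sq (dilate t u) = L2sq u"
    and grad_sq_dilate: "grad_sq (dilate t u) = t\<^sup>2 * grad_sq u"
    and Lp_power_dilate: "Lp_power p (dilate t u) = t powr (real CARD('n) * (p - 2) / 2) * Lp_power p u"
proof -
  have a: "(t powr (real CARD('n) / 2))\<^sup>2 = t ^ CARD('n)"
    using t by (simp add: powr_power powr_realpow)
  show "dilate t u \<in> H1" unfolding dilate_def by (rule rescale_H1[OF assms])
  show "L2sq (dilate t u) = L2sq u" "grad_sq (dilate t u) = t\<^sup>2 * grad_sq u"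
    unfolding dilate_def L2sq_rescale[OF assms] grad_sq_rescale[OF assms] a using t by simp_all
  have "\<bar>t powr (real CARD('n) / 2)\<bar> powr p / t ^ CARD('n) = t powr (real CARD('n) / 2 * p) / t powr CARD('n)"
    using t by (simp add: powr_powr powr_realpow)
  also have "\<dots> = t powr (real CARD('n) * (p - 2) / 2)"
    by (simp add: powr_diff[symmetric] algebra_simps diff_divide_distrib)
  finally show "Lp_power p (dilate t u) = t powr (real CARD('n) * (p - 2) / 2) * Lp_power p u"
    unfolding dilate_def Lp_power_rescale[OF assms] by simp
qed

lemma dilate_mass_sphere: "u \<in> mass_sphere c \<Longrightarrow> t > 0 \<Longrightarrow> dilate t u \<in> mass_sphere c"
  by (simp add: mass_sphere_iff dilate_H1 L2sq_dilate)

lemma energy_dilate: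
  fixes u :: "real ^ 'n \<Rightarrow> real"
  assumes "p > 0" "u \<in> H1" "t > 0"
  shows "energy p (dilate t u) = grad_sq u / 2 * t\<^sup>2 - Lp_power p u / p * t powr (real CARD('n) * (p - 2) / 2)"
  using assms by (simp add: energy_eq grad_sq_dilate Lp_power_dilate mult.commute)

text \<open>Both the dilated function and its weak gradient are of the form treated in
  \<open>L2_dilation_continuous\<close>, with amplitudes \<open>\<tau> powr (d / 2)\<close> and \<open>\<tau> powr (d / 2) * \<tau>\<close> in dimension \<open>d\<close>.\<close>

lemma continuous_H1_path_dilate:
  fixes u :: "real ^ 'n \<Rightarrow> real"
  assumes u: "u \<in> H1" and \<tau>: "continuous_on {0..1} \<tau>" and pos: "\<And>t. t \<in> {0..1} \<Longrightarrow> \<tau> t > 0"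
  shows "continuous_H1_path (\<lambda>t. dilate (\<tau> t) u)"
  unfolding continuous_H1_path_def H1_norm_tendsto_0_iff
proof (intro ballI conjI)
  fix t :: real assume t: "t \<in> {0..1}"
  note w = H1_weak_grad[OF u]
  let ?F = "at t within {0..1::real}" and ?e = "real CARD('n) / 2"
  have \<tau>t: "(\<tau> \<longlongrightarrow> \<tau> t) ?F" using \<tau> t by (simp add: continuous_on_def)
  have a: "((\<lambda>s. \<tau> s powr ?e) \<longlongrightarrow> \<tau> t powr ?e) ?F"
    using pos[OF t] by (intro tendsto_intros \<tau>t) auto
  show "((\<lambda>s. L2sq (\<lambda>x. dilate (\<tau> s) u x - dilate (\<tau> t) u x)) \<longlongrightarrow> 0) ?F"
    using L2_dilation_continuous[OF w(1) a \<tau>t] pos[OF t] by (simp add: dilate_def rescale_def)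
  have b: "((\<lambda>s. \<tau> s powr ?e * \<tau> s) \<longlongrightarrow> \<tau> t powr ?e * \<tau> t) ?F"
    by (intro tendsto_mult a \<tau>t)
  have lim: "((\<lambda>s. L2sq (\<lambda>x. (\<tau> s powr ?e * \<tau> s) *\<^sub>R weak_grad u (\<tau> s *\<^sub>R x)
      - (\<tau> t powr ?e * \<tau> t) *\<^sub>R weak_grad u (\<tau> t *\<^sub>R x))) \<longlongrightarrow> 0) ?F"
    using L2_dilation_continuous[OF w(2) b \<tau>t] pos[OF t] by simp
  have eq: "L2sq (\<lambda>x. (\<tau> s powr ?e * \<tau> s) *\<^sub>R weak_grad u (\<tau> s *\<^sub>R x)
      - (\<tau> t powr ?e * \<tau> t) *\<^sub>R weak_grad u (\<tau> t *\<^sub>R x)) = grad_sq (\<lambda>x. dilate (\<tau> s) u x - dilate (\<tau> t) u x)"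
    if s: "s \<in> {0..1}" for s
  proof -
    have g: "AE x in lborel. weak_grad (dilate (\<tau> r) u) x = (\<tau> r powr ?e * \<tau> r) *\<^sub>R weak_grad u (\<tau> r *\<^sub>R x)"
      if "r \<in> {0..1}" for r
      using H1_scale(3)[OF u pos[OF that], of "\<tau> r powr ?e"] by (simp add: dilate_def rescale_def)
    have [measurable]: "weak_grad u \<in> borel_measurable borel" using w(2) by (simp add: Lp_space_2_iff)
    have m: "weak_grad (dilate (\<tau> r) u) \<in> borel_measurable borel" if "r \<in> {0..1}" for r
      using H1_weak_grad(2)[OF dilate_H1[OF u pos[OF that]]] by (simp add: Lp_space_2_iff)
    note [measurable] = m[OF s] m[OF t]
    have "grad_sq (\<lambda>x. dilate (\<tau> s) u x - dilate (\<tau> t) u x)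
        = L2sq (\<lambda>x. weak_grad (dilate (\<tau> s) u) x - weak_grad (dilate (\<tau> t) u) x)"
      unfolding grad_sq_def using u pos s t by (intro H1_diff(2) dilate_H1) auto
    also have "\<dots> = L2sq (\<lambda>x. (\<tau> s powr ?e * \<tau> s) *\<^sub>R weak_grad u (\<tau> s *\<^sub>R x)
      - (\<tau> t powr ?e * \<tau> t) *\<^sub>R weak_grad u (\<tau> t *\<^sub>R x))"
    proof (rule L2sq_cong_AE)
      show "AE x in lborel. weak_grad (dilate (\<tau> s) u) x - weak_grad (dilate (\<tau> t) u) x =
          (\<tau> s powr ?e * \<tau> s) *\<^sub>R weak_grad u (\<tau> s *\<^sub>R x) - (\<tau> t powr ?e * \<tau> t) *\<^sub>R weak_grad u (\<tau> t *\<^sub>R x)"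
        using g[OF s] g[OF t] by eventually_elim simp
    qed measurable
    finally show ?thesis by simp
  qed
  have "\<forall>\<^sub>F s in ?F. s \<in> {0..1}" by (simp add: eventually_at_filter)
  then have "\<forall>\<^sub>F s in ?F. L2sq (\<lambda>x. (\<tau> s powr ?e * \<tau> s) *\<^sub>R weak_grad u (\<tau> s *\<^sub>R x)
      - (\<tau> t powr ?e * \<tau> t) *\<^sub>R weak_grad u (\<tau> t *\<^sub>R x)) = grad_sq (\<lambda>x. dilate (\<tau> s) u x - dilate (\<tau> t) u x)"
    by eventually_elim (rule eq)
  with lim show "((\<lambda>s. grad_sq (\<lambda>x. dilate (\<tau> s) u x - dilate (\<tau> t) u x)) \<longlongrightarrow> 0) ?F"
    by (rule Lim_transform_eventually)
qed

definition join_paths :: "(real \<Rightarrow> 'b) \<Rightarrow> (real \<Rightarrow> 'b) \<Rightarrow> real \<Rightarrow> 'b" where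
  "join_paths g h t = (if t \<le> 1 / 2 then g (2 * t) else h (2 * t - 1))"

lemma tendsto_reparametrize:
  fixes f :: "real \<Rightarrow> real" and r :: "real \<Rightarrow> real"
  assumes f: "(f \<longlongrightarrow> l) (at (r t) within {0..1})"
    and r: "(r \<longlongrightarrow> r t) (at t within S)" "inj r" "\<And>s. s \<in> S \<Longrightarrow> r s \<in> {0..1}"
    and eq: "\<And>s. s \<in> S \<Longrightarrow> F s = f (r s)"
  shows "(F \<longlongrightarrow> l) (at t within S)"
proof -
  have "filterlim r (at (r t) within {0..1}) (at t within S)"
    unfolding filterlim_at using r by (auto simp: eventually_at_filter inj_eq)
  then have "((\<lambda>s. f (r s)) \<longlongrightarrow> l) (at t within S)" by (rule filterlim_compose[OF f])
  moreover have "\<forall>\<^sub>F s in at t within S. f (r s) = F s" using eq by (auto simp: eventually_at_filter)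
  ultimately show ?thesis by (rule Lim_transform_eventually)
qed

lemma at_within_closed_eq_bot:
  fixes t :: "'a::t1_space"
  assumes "closed S" "t \<notin> S"
  shows "at t within S = bot"
proof -
  have "\<forall>\<^sub>F s in nhds t. s \<in> - S"
    using assms by (intro eventually_nhds_in_open) auto
  then show ?thesis
    by (auto simp: trivial_limit_def eventually_at_filter elim: eventually_mono)
qed

lemma continuous_H1_path_join:
  assumes g: "continuous_H1_path g" and h: "continuous_H1_path h" and gh: "g 1 = h 0"
  shows "continuous_H1_path (join_paths g h)"
  unfolding continuous_H1_path_def
proof
  fix t :: real assume t: "t \<in> {0..1}"
  define j where "j = join_paths g h"
  let ?D = "\<lambda>s. H1_norm (\<lambda>x. j s x - j t x)"
  have j1: "j s = g (2 * s)" if "s \<le> 1 / 2" for s using that by (simp add: j_def join_paths_def)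
  have j2: "j s = h (2 * s - 1)" if "1 / 2 \<le> s" for s
  proof (cases "s = 1 / 2")
    case True
    then show ?thesis using gh by (simp only: j_def join_paths_def) simp
  qed (use that in \<open>auto simp: j_def join_paths_def\<close>)
  have "(?D \<longlongrightarrow> 0) (at t within {0..1/2})"
  proof (cases "t \<le> 1 / 2")
    case True
    have "((\<lambda>s. H1_norm (\<lambda>x. g s x - g (2 * t) x)) \<longlongrightarrow> 0) (at (2 * t) within {0..1})"
      using g t True by (simp add: continuous_H1_path_def)
    moreover have "((\<lambda>s. 2 * s) \<longlongrightarrow> 2 * t) (at t within {0..1/2})" by (intro tendsto_intros)
    ultimately show ?thesis
      by (rule tendsto_reparametrize) (auto simp: j1 j1[OF True] inj_def)
  next
    case False
    then have "at t within {0..1/2} = bot" by (intro at_within_closed_eq_bot) auto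
    then show ?thesis by simp
  qed
  moreover have "(?D \<longlongrightarrow> 0) (at t within {1/2..1})"
  proof (cases "1 / 2 \<le> t")
    case True
    have "((\<lambda>s. H1_norm (\<lambda>x. h s x - h (2 * t - 1) x)) \<longlongrightarrow> 0) (at (2 * t - 1) within {0..1})"
      using h t True by (simp add: continuous_H1_path_def)
    moreover have "((\<lambda>s. 2 * s - 1) \<longlongrightarrow> 2 * t - 1) (at t within {1/2..1})" by (intro tendsto_intros)
    ultimately show ?thesis
      by (rule tendsto_reparametrize) (auto simp: j2 j2[OF True] inj_def)
  next
    case False
    then have "at t within {1/2..1} = bot" by (intro at_within_closed_eq_bot) auto
    then show ?thesis by simp
  qed
  ultimately have "(?D \<longlongrightarrow> 0) (at t within {0..1/2} \<union> {1/2..1})" by (rule Lim_Un)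
  moreover have "{0..1/2} \<union> {1/2..1} = {0..1::real}" by auto
  ultimately show "((\<lambda>s. H1_norm (\<lambda>x. join_paths g h s x - join_paths g h t x)) \<longlongrightarrow> 0) (at t within {0..1})"
    by (simp add: j_def)
qed

section \<open>One-variable estimates along a dilation\<close>

text \<open>For positive coefficients the fibre map increases up to a single maximum and decreases afterwards, since the sign of its
  derivative is that of \<open>2 * \<alpha> - \<sigma> * \<beta> * t powr (\<sigma> - 2)\<close>, a decreasing function of \<open>t\<close>. If some
  value before \<open>t = 1\<close> exceeds the value at \<open>1\<close>, then the maximum lies before \<open>1\<close>, and the map
  decreases from there on.\<close>

lemma fibre_map_past_maximum:
  fixes \<alpha> \<beta> \<sigma> t0 :: real
  assumes \<sigma>: "\<sigma> > 2" and \<alpha>: "\<alpha> \<ge> 0" and \<beta>: "\<beta> \<ge> 0" and t0: "0 < t0" "t0 < 1"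
    and gt: "\<alpha> * t0\<^sup>2 - \<beta> * t0 powr \<sigma> > \<alpha> - \<beta>"
  shows "\<beta> > 0" and "\<And>t. t \<ge> 1 \<Longrightarrow> \<alpha> * t\<^sup>2 - \<beta> * t powr \<sigma> \<le> \<alpha> - \<beta>"
proof -
  define \<phi> where "\<phi> t = \<alpha> * t\<^sup>2 - \<beta> * t powr \<sigma>" for t
  have D: "(\<phi> has_real_derivative t * (2 * \<alpha> - \<sigma> * \<beta> * t powr (\<sigma> - 2))) (at t)" if "t > 0" for t
  proof -
    have "t powr (\<sigma> - 1) = t * t powr (\<sigma> - 2)"
      using that powr_add[of t 1 "\<sigma> - 2"] by simp
    then show ?thesis unfolding \<phi>_def using that
      by (auto intro!: derivative_eq_intros simp: algebra_simps)
  qed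
  have \<phi>1: "\<phi> 1 = \<alpha> - \<beta>" by (simp add: \<phi>_def)
  have key: "2 * \<alpha> \<le> \<sigma> * \<beta>"
  proof (rule ccontr)
    assume neg: "\<not> 2 * \<alpha> \<le> \<sigma> * \<beta>"
    have "\<phi> t0 \<le> \<phi> 1"
    proof (rule DERIV_nonneg_imp_nondecreasing[where f=\<phi> and a=t0 and b=1])
      fix x assume x: "t0 \<le> x" "x \<le> 1"
      have "x powr (\<sigma> - 2) \<le> 1" using x t0 \<sigma> by (intro powr_le1) auto
      then have "\<sigma> * \<beta> * x powr (\<sigma> - 2) \<le> \<sigma> * \<beta>" using \<sigma> \<beta> by (intro mult_left_le) auto
      then have "0 \<le> x * (2 * \<alpha> - \<sigma> * \<beta> * x powr (\<sigma> - 2))" using neg x t0 by (intro mult_nonneg_nonneg) auto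
      then show "\<exists>y. (\<phi> has_real_derivative y) (at x) \<and> 0 \<le> y" using D[of x] x t0 by auto
    qed (use t0 in auto)
    then show False using gt by (simp add: \<phi>1) (simp add: \<phi>_def)
  qed
  show "\<beta> > 0"
  proof (rule ccontr)
    assume "\<not> \<beta> > 0"
    then show False using \<beta> \<alpha> key gt by auto
  qed
  show "\<alpha> * t\<^sup>2 - \<beta> * t powr \<sigma> \<le> \<alpha> - \<beta>" if t: "t \<ge> 1" for t
  proof -
    have "\<phi> t \<le> \<phi> 1"
    proof (rule DERIV_nonpos_imp_nonincreasing[where f=\<phi> and a=1 and b=t])
      fix x assume x: "1 \<le> x" "x \<le> t"
      have "1 \<le> x powr (\<sigma> - 2)" using x \<sigma> by (intro ge_one_powr_ge_zero) auto
      then have "\<sigma> * \<beta> * 1 \<le> \<sigma> * \<beta> * x powr (\<sigma> - 2)" using \<sigma> \<beta> by (intro mult_left_mono) auto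
      then have "x * (2 * \<alpha> - \<sigma> * \<beta> * x powr (\<sigma> - 2)) \<le> 0" using key x by (intro mult_nonneg_nonpos) auto
      then show "\<exists>y. (\<phi> has_real_derivative y) (at x) \<and> y \<le> 0" using D[of x] x by auto
    qed (use t in auto)
    then show ?thesis by (simp add: \<phi>1) (simp add: \<phi>_def)
  qed
qed

lemma fibre_map_eventually_negative:
  fixes \<alpha> \<beta> \<sigma> :: real
  assumes "\<sigma> > 2" "\<beta> > 0"
  shows "\<exists>T\<ge>1. \<alpha> * T\<^sup>2 - \<beta> * T powr \<sigma> < 0"
proof -
  have "filterlim (\<lambda>T. T powr (\<sigma> - 2)) at_top at_top"
    using assms by real_asymp
  then have "\<forall>\<^sub>F T in at_top. \<alpha> / \<beta> < T powr (\<sigma> - 2)"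
    by (simp add: filterlim_at_top_dense)
  then have "\<forall>\<^sub>F T in at_top. \<alpha> / \<beta> < T powr (\<sigma> - 2) \<and> 1 \<le> T"
    using eventually_ge_at_top by (rule eventually_conj)
  then obtain T where T: "\<alpha> / \<beta> < T powr (\<sigma> - 2)" "1 \<le> T"
    using eventually_happens by force
  have "T powr \<sigma> = T\<^sup>2 * T powr (\<sigma> - 2)"
    using T(2) powr_add[of T 2 "\<sigma> - 2"] by simp
  moreover have "T\<^sup>2 * \<alpha> < T\<^sup>2 * (\<beta> * T powr (\<sigma> - 2))"
    using T assms by (intro mult_strict_left_mono) (auto simp: field_simps)
  ultimately show ?thesis using T(2) by (intro exI[of _ T]) (simp add: algebra_simps)
qed

lemma small_dilation_parameter:
  fixes G K :: real assumes "K > 0" "G \<ge> 0"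
  shows "\<exists>t. 0 < t \<and> t \<le> 1 \<and> (\<forall>s. 0 < s \<longrightarrow> s \<le> t \<longrightarrow> s\<^sup>2 * G \<le> K)"
proof (intro exI conjI allI impI)
  let ?t = "min 1 (sqrt (K / (G + 1)))"
  show "0 < ?t" "?t \<le> 1" using assms by auto
  fix s :: real assume s: "0 < s" "s \<le> ?t"
  then have "s \<le> sqrt (K / (G + 1))" by simp
  then have "s\<^sup>2 \<le> (sqrt (K / (G + 1)))\<^sup>2" using s by (intro power_mono) auto
  also have "\<dots> = K / (G + 1)" using assms by simp
  finally have "s\<^sup>2 * (G + 1) \<le> K" using assms by (simp add: pos_le_divide_eq)
  moreover have "0 \<le> s\<^sup>2" by simp
  ultimately show "s\<^sup>2 * G \<le> K" unfolding distrib_left by linarith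
qed

section \<open>The level does not depend on the gradient bound\<close>

lemma mp_level_le: 
  fixes g :: "real \<Rightarrow> real ^ 'n \<Rightarrow> real"
  assumes "g \<in> mp_paths p K c" "\<And>t. t \<in> {0..1} \<Longrightarrow> ereal (energy p (g t)) \<le> X"
  shows "mp_level TYPE('n) p K c \<le> X"
  unfolding mp_level_def using assms by (intro INF_lower2[of g] SUP_least)

text \<open>The two conditions on \<open>p\<close>, free of division: the first says that \<open>p\<close> lies above the
  mass-critical exponent, the second that it lies below the Sobolev exponent when that is finite.\<close>

locale supercritical =
  fixes p :: real and dim :: "'n::finite itself"
  assumes p_gt: "real CARD('n) * (p - 2) > 4"
    and p_subcritical: "real CARD('n) * (p - 2) / 2 < p"
begin

text \<open>The power of \<open>t\<close> by which \<open>dilate t\<close> multiplies the \<open>p\<close>-th power of the $L^p$ norm. It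
  exceeds two, so that this term dominates the gradient for large \<open>t\<close> and is dominated by it for
  small \<open>t\<close>.\<close>

definition \<sigma> :: real where "\<sigma> = real CARD('n) * (p - 2) / 2"

lemma \<sigma>_gt: "\<sigma> > 2" using p_gt by (simp add: \<sigma>_def)

lemma p_pos: "p > 0" using \<sigma>_gt p_subcritical by (simp add: \<sigma>_def)

lemma energy_along_dilation: "u \<in> H1 \<Longrightarrow> t > 0 \<Longrightarrow>
   energy p (dilate t (u :: real ^ 'n \<Rightarrow> real)) = grad_sq u / 2 * t\<^sup>2 - Lp_power p u / p * t powr \<sigma>"
  using energy_dilate[OF p_pos] by (simp add: \<sigma>_def)

lemma dilation_path:
  fixes u :: "real ^ 'n \<Rightarrow> real"
  assumes u: "u \<in> mass_sphere c" and t: "0 < t" "t \<le> T" 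
    and small: "t\<^sup>2 * grad_sq u \<le> K" and neg: "energy p (dilate T u) < 0"
  shows "(\<lambda>s. dilate (t + s * (T - t)) u) \<in> mp_paths p K c"
proof -
  have H: "u \<in> H1" using u by (simp add: mass_sphere_iff)
  have pos: "t + s * (T - t) > 0" if "s \<in> {0..1}" for s
    using that t by (intro add_pos_nonneg) auto
  have "continuous_H1_path (\<lambda>s. dilate (t + s * (T - t)) u)"
    by (rule continuous_H1_path_dilate[OF H _ pos]) (auto intro!: continuous_intros)
  moreover have "dilate (t + s * (T - t)) u \<in> mass_sphere c" if "s \<in> {0..1}" for s
    using u pos[OF that] by (rule dilate_mass_sphere)
  moreover have "dilate t u \<in> small_grad_set K c"
    using dilate_mass_sphere[OF u t(1)] small by (simp add: small_grad_set_iff grad_sq_dilate[OF H t(1)])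
  ultimately show ?thesis using neg by (simp add: mp_paths_def)
qed

text \<open>The mountain pass geometry forces a starting point \<open>u\<close> not to lie beyond the maximum of its
  fibre map. Otherwise the energy would decrease from \<open>u\<close> on when \<open>u\<close> is dilated with growing \<open>t\<close>, all the way
  to negative values. That dilation would be an admissible path whose maximal energy is attained at its
  starting point, which the geometry excludes.\<close>

lemma mp_geometry_dilate_energy_le:
  fixes u :: "real ^ 'n \<Rightarrow> real"
  assumes geo: "mp_geometry TYPE('n) p K c" and u: "u \<in> small_grad_set K c" and t: "0 < t" "t \<le> 1"
  shows "energy p (dilate t u) \<le> energy p u"
proof (rule ccontr)
  assume neg: "\<not> energy p (dilate t u) \<le> energy p u"
  have H: "u \<in> H1" "u \<in> mass_sphere c" "grad_sq u \<le> K" using u by (auto simp: small_grad_set_iff mass_sphere_iff)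
  define \<alpha> \<beta> where "\<alpha> = grad_sq u / 2" and "\<beta> = Lp_power p u / p"
  have ab: "\<alpha> \<ge> 0" "\<beta> \<ge> 0" using p_pos by (simp_all add: \<alpha>_def \<beta>_def grad_sq_nonneg Lp_power_nonneg)
  have en: "energy p (dilate s u) = \<alpha> * s\<^sup>2 - \<beta> * s powr \<sigma>" if "s > 0" for s
    using energy_along_dilation[OF H(1) that] by (simp add: \<alpha>_def \<beta>_def)
  have en1: "energy p u = \<alpha> - \<beta>" using en[of 1] by simp
  have "t \<noteq> 1" using neg by auto
  then have "t < 1" "\<alpha> * t\<^sup>2 - \<beta> * t powr \<sigma> > \<alpha> - \<beta>" using t neg en1 en by auto
  note r = fibre_map_past_maximum[OF \<sigma>_gt ab t(1) this]
  \<comment> \<open>The forbidden path: dilate from the function itself until the energy is negative.\<close>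
  obtain T where T: "T \<ge> 1" "\<alpha> * T\<^sup>2 - \<beta> * T powr \<sigma> < 0"
    using fibre_map_eventually_negative[OF \<sigma>_gt r(1)] by blast
  define h where "h = (\<lambda>s. dilate (1 + s * (T - 1)) u)"
  have h: "h \<in> mp_paths p K c"
    unfolding h_def using T H(3) en[of T] by (intro dilation_path H) auto
  have "mp_level TYPE('n) p K c \<le> ereal (energy p u)"
  proof (rule mp_level_le[OF h])
    fix s :: real assume "s \<in> {0..1}"
    then have "1 + s * (T - 1) \<ge> 1" using T(1) by simp
    then show "ereal (energy p (h s)) \<le> ereal (energy p u)"
      using r(2) en unfolding h_def en1 by simp
  qed
  moreover have "energy p u \<le> max (energy p (h 0)) (energy p (h 1))" by (simp add: h_def)
  ultimately have "mp_level TYPE('n) p K c \<le> ereal (max (energy p (h 0)) (energy p (h 1)))"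
    by (meson ereal_less_eq(3) order_trans)
  then show False using geo h unfolding mp_geometry_def by (meson leD)
qed

text \<open>Shrinking the set of starting points can only raise the level. Conversely, a path that starts
  at \<open>u\<close> with moderate gradient is extended backwards by the dilation from \<open>dilate t u\<close> to \<open>u\<close> with
  small \<open>t\<close>. By \<open>mp_geometry_dilate_energy_le\<close> the energy on the added piece stays below that of
  \<open>u\<close>, so the maximum along the path is not increased.\<close>

lemma mp_level_shrink:
  assumes geo: "mp_geometry TYPE('n) p K c" and K': "0 < K'" "K' \<le> K"
  shows "mp_level TYPE('n) p K' c = mp_level TYPE('n) p K c"
proof (rule antisym)
  have "mp_paths p K' c \<subseteq> (mp_paths p K c :: (real \<Rightarrow> real ^ 'n \<Rightarrow> real) set)"
    using K' by (auto simp: mp_paths_def small_grad_set_def)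
  then show "mp_level TYPE('n) p K c \<le> mp_level TYPE('n) p K' c"
    unfolding mp_level_def by (intro INF_superset_mono) auto
  show "mp_level TYPE('n) p K' c \<le> mp_level TYPE('n) p K c"
    unfolding mp_level_def[of _ p K c]
  proof (rule INF_greatest)
    fix g :: "real \<Rightarrow> real ^ 'n \<Rightarrow> real" assume g: "g \<in> mp_paths p K c"
    define u where "u = g 0"
    have u: "u \<in> small_grad_set K c" using g by (simp add: mp_paths_def u_def)
    then have H: "u \<in> H1" "u \<in> mass_sphere c" by (auto simp: small_grad_set_iff mass_sphere_iff)
    obtain t where t: "0 < t" "t \<le> 1" "t\<^sup>2 * grad_sq u \<le> K'"
      using small_dilation_parameter[OF K'(1) grad_sq_nonneg[of u]] by blast
    define d where "d = (\<lambda>s. dilate (t + s * (1 - t)) u)"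
    have pos: "t + s * (1 - t) > 0" "t + s * (1 - t) \<le> 1" if "s \<in> {0..1}" for s
    proof -
      show "t + s * (1 - t) > 0" using that t by (intro add_pos_nonneg) auto
      have "s * (1 - t) \<le> 1 * (1 - t)" using that t by (intro mult_right_mono) auto
      then show "t + s * (1 - t) \<le> 1" by simp
    qed
    have dc: "continuous_H1_path d"
      unfolding d_def by (rule continuous_H1_path_dilate[OF H(1) _ pos(1)]) (auto intro!: continuous_intros)
    have dm: "d s \<in> mass_sphere c" if "s \<in> {0..1}" for s
      unfolding d_def using H(2) pos(1)[OF that] by (rule dilate_mass_sphere)
    have de: "energy p (d s) \<le> energy p (g 0)" if "s \<in> {0..1}" for s
      unfolding d_def u_def[symmetric] using pos[OF that] by (intro mp_geometry_dilate_energy_le[OF geo u])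
    have d0: "d 0 \<in> small_grad_set K' c"
      using dm[of 0] t by (simp add: small_grad_set_iff d_def grad_sq_dilate[OF H(1)])
    have d1: "d 1 = g 0" by (simp add: d_def u_def)
    have j: "join_paths d g \<in> mp_paths p K' c"
      unfolding mp_paths_def
    proof (intro CollectI conjI ballI)
      show "continuous_H1_path (join_paths d g)"
        using g d1 by (intro continuous_H1_path_join dc) (auto simp: mp_paths_def)
      show "join_paths d g s \<in> mass_sphere c" if "s \<in> {0..1}" for s
        using g dm that by (auto simp: join_paths_def mp_paths_def)
      show "join_paths d g 0 \<in> small_grad_set K' c" using d0 by (simp add: join_paths_def)
      show "energy p (join_paths d g 1) < 0" using g by (simp add: join_paths_def mp_paths_def)
    qed
    show "mp_level TYPE('n) p K' c \<le> (SUP t\<in>{0..1}. ereal (energy p (g t)))"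
    proof (rule mp_level_le[OF j])
      fix s :: real assume s: "s \<in> {0..1}"
      have "\<exists>r\<in>{0..1}. energy p (join_paths d g s) \<le> energy p (g r)"
      proof (cases "s \<le> 1 / 2")
        case True
        then show ?thesis using de[of "2 * s"] s by (intro bexI[of _ 0]) (auto simp: join_paths_def)
      next
        case False
        then show ?thesis using s by (intro bexI[of _ "2 * s - 1"]) (auto simp: join_paths_def)
      qed
      then show "ereal (energy p (join_paths d g s)) \<le> (SUP t\<in>{0..1}. ereal (energy p (g t)))"
        by (auto intro: SUP_upper2)
    qed
  qed
qed

section \<open>Scaling of the level\<close>

text \<open>The amplitude \<open>a\<close> and the dilation \<open>b = a powr ((p - 2) / 2)\<close> are matched so that the squared
  gradient and the \<open>p\<close>-th power of the $L^p$ norm, and with them the energy, are multiplied by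
  the same factor \<open>a powr (p - \<sigma>)\<close>. The mass is multiplied by \<open>a powr (2 - \<sigma>)\<close>, which is a
  negative power of \<open>a\<close>. Composing with this rescaling maps admissible paths to admissible paths.\<close>

lemma mp_level_scale_le:
  assumes a: "a > 0"
  shows "mp_level TYPE('n) p (a powr (p - \<sigma>) * K) (a powr (2 - \<sigma>) * c) \<le> ereal (a powr (p - \<sigma>)) * mp_level TYPE('n) p K c"
proof -
  define b where "b = a powr ((p - 2) / 2)"
  define s where "s = a powr (p - \<sigma>)"
  have b: "b > 0" and s: "s > 0" using a by (simp_all add: b_def s_def)
  have bn: "b ^ CARD('n) = a powr \<sigma>"
    using a by (simp add: b_def powr_power \<sigma>_def mult.commute)
  have b2: "b\<^sup>2 = a powr (p - 2)"
    unfolding b_def power2_eq_square powr_add[symmetric] by simp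
  have a2: "a\<^sup>2 = a powr 2" using a by simp
  \<comment> \<open>The factors for the mass, the gradient term and the power term; the last two agree.\<close>
  have m: "a\<^sup>2 / b ^ CARD('n) = a powr (2 - \<sigma>)"
    unfolding bn a2 by (simp add: powr_diff)
  have gs: "a\<^sup>2 * b\<^sup>2 / b ^ CARD('n) = s"
    unfolding bn b2 a2 s_def by (simp add: powr_add[symmetric] powr_diff[symmetric])
  have ps: "\<bar>a\<bar> powr p / b ^ CARD('n) = s"
    unfolding bn s_def using a by (simp add: powr_diff)
  have mass: "rescale a b u \<in> mass_sphere (a powr (2 - \<sigma>) * c)" if "u \<in> mass_sphere c" for u :: "real ^ 'n \<Rightarrow> real"
    using that rescale_H1[OF _ b, of u a] L2sq_rescale[OF _ b, of u a, unfolded m]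
    by (simp add: mass_sphere_iff)
  have grad: "grad_sq (rescale a b u) = s * grad_sq u" if "u \<in> mass_sphere c" for u :: "real ^ 'n \<Rightarrow> real"
    using that grad_sq_rescale[OF _ b, of u a, unfolded gs] by (simp add: mass_sphere_iff)
  have en: "energy p (rescale a b u) = s * energy p u" if "u \<in> mass_sphere c" for u :: "real ^ 'n \<Rightarrow> real"
    using that grad[OF that] Lp_power_rescale[OF _ b, of u p a, unfolded ps]
    by (simp add: energy_eq[OF p_pos] mass_sphere_iff right_diff_distrib)
  have "ereal (1 / s) * mp_level TYPE('n) p (s * K) (a powr (2 - \<sigma>) * c) \<le> mp_level TYPE('n) p K c"
    unfolding mp_level_def[of _ p K c]
  proof (rule INF_greatest)
    fix g :: "real \<Rightarrow> real ^ 'n \<Rightarrow> real" assume g: "g \<in> mp_paths p K c"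
    let ?S = "SUP t\<in>{0..1}. ereal (energy p (g t))"
    have gm: "g t \<in> mass_sphere c" if "t \<in> {0..1}" for t using g that by (simp add: mp_paths_def)
    have "(\<lambda>t. rescale a b (g t)) \<in> mp_paths p (s * K) (a powr (2 - \<sigma>) * c)"
      unfolding mp_paths_def
    proof (intro CollectI conjI ballI)
      show "continuous_H1_path (\<lambda>t. rescale a b (g t))"
        using g gm by (intro continuous_H1_path_rescale b) (auto simp: mp_paths_def mass_sphere_iff)
      show "rescale a b (g t) \<in> mass_sphere (a powr (2 - \<sigma>) * c)" if "t \<in> {0..1}" for t
        using gm[OF that] by (rule mass)
      show "rescale a b (g 0) \<in> small_grad_set (s * K) (a powr (2 - \<sigma>) * c)"
        using g s gm[of 0] mass grad by (simp add: mp_paths_def small_grad_set_iff)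
      show "energy p (rescale a b (g 1)) < 0"
        using g s gm[of 1] en by (simp add: mp_paths_def mult_pos_neg)
    qed
    then have "mp_level TYPE('n) p (s * K) (a powr (2 - \<sigma>) * c) \<le> ereal s * ?S"
    proof (rule mp_level_le)
      fix t :: real assume t: "t \<in> {0..1}"
      have "ereal (energy p (g t)) \<le> ?S" using t by (rule SUP_upper)
      then have "ereal s * ereal (energy p (g t)) \<le> ereal s * ?S"
        using s by (intro ereal_mult_left_mono) auto
      then show "ereal (energy p (rescale a b (g t))) \<le> ereal s * ?S"
        using en[OF gm[OF t]] by simp
    qed
    then have "ereal (1 / s) * mp_level TYPE('n) p (s * K) (a powr (2 - \<sigma>) * c) \<le> ereal (1 / s) * (ereal s * ?S)"
      using s by (intro ereal_mult_left_mono) auto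
    also have "\<dots> = ?S" using s by (simp add: mult.assoc[symmetric])
    finally show "ereal (1 / s) * mp_level TYPE('n) p (s * K) (a powr (2 - \<sigma>) * c) \<le> ?S" .
  qed
  then have "ereal s * (ereal (1 / s) * mp_level TYPE('n) p (s * K) (a powr (2 - \<sigma>) * c)) \<le> ereal s * mp_level TYPE('n) p K c"
    using s by (intro ereal_mult_left_mono) auto
  then show ?thesis using s by (simp add: s_def[symmetric] mult.assoc[symmetric])
qed

lemma mp_level_scale:
  assumes a: "a > 0"
  shows "mp_level TYPE('n) p (a powr (p - \<sigma>) * K) (a powr (2 - \<sigma>) * c) = ereal (a powr (p - \<sigma>)) * mp_level TYPE('n) p K c"
    (is "?l = ereal ?s * ?r")
proof (rule antisym)
  show "?l \<le> ereal ?s * ?r" by (rule mp_level_scale_le[OF a])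
  have inv: "(1 / a) powr x * (a powr x * y) = y" for x y
    using a by (simp add: powr_divide)
  have "?r \<le> ereal ((1 / a) powr (p - \<sigma>)) * ?l"
    using mp_level_scale_le[of "1 / a" "a powr (p - \<sigma>) * K" "a powr (2 - \<sigma>) * c"] a
    by (simp only: inv) simp
  then have "ereal ?s * ?r \<le> ereal ?s * (ereal ((1 / a) powr (p - \<sigma>)) * ?l)"
    by (intro ereal_mult_left_mono) auto
  also have "\<dots> = ?l" using a by (simp add: mult.assoc[symmetric] powr_divide)
  finally show "ereal ?s * ?r \<le> ?l" .
qed

end

section \<open>The level is positive and finite\<close>

lemma test_function_Lp_power_pos:
  fixes f :: "real ^ 'n \<Rightarrow> real"
  assumes f: "f \<in> test_functions" and x0: "f x0 \<noteq> 0" and q: "q > 0"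
  shows "Lp_power q f > 0"
proof -
  have c: "continuous_on UNIV f" using f by (rule test_functions_continuous)
  obtain S where S: "compact S" "\<And>x. x \<notin> S \<Longrightarrow> f x = 0"
    using test_functions_support[OF f] by blast
  have "continuous_on UNIV (\<lambda>x. norm (f x) powr q)"
    using q by (intro continuous_on_powr' continuous_intros c) auto
  then have i: "integrable lborel (\<lambda>x. norm (f x) powr q)"
    using S q by (intro compact_support_integrable[of _ S]) auto
  have "Lp_power q f \<noteq> 0"
  proof
    assume "Lp_power q f = 0"
    then have "AE x in lborel. norm (f x) powr q = 0"
      using integral_nonneg_eq_0_iff_AE[OF i] by (simp add: Lp_power_def)
    then have "AE x in lborel. x \<in> {x. f x = 0}" by eventually_elim simp
    then have "AE x in lebesgue. x \<in> {x. f x = 0}" by (rule AE_completion)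
    moreover have "closed {x. f x = 0}" using c by (intro closed_Collect_eq continuous_intros)
    ultimately have "x0 \<in> {x. f x = 0}" by (intro mem_closed_if_AE_lebesgue) auto
    then show False using x0 by simp
  qed
  then show ?thesis using Lp_power_nonneg[of q f] by linarith
qed

text \<open>A multiple of a bump function. Positivity of \<open>Lp_power\<close> is recorded because \<open>Lp_power\<close> is
  zero by convention when the integral diverges.\<close>

lemma mass_sphere_exists:
  assumes c: "c > 0" and p: "p > 0"
  obtains u :: "real ^ 'n \<Rightarrow> real" where "u \<in> mass_sphere c" "Lp_power p u > 0"
proof -
  define f :: "real ^ 'n \<Rightarrow> real" where "f = bump (\<chi> i. - 1) (\<chi> i. 1) 0"
  have f: "f \<in> test_functions" unfolding f_def by (rule bump_test_function)
  have "f 0 \<noteq> 0" unfolding f_def bump_nonzero_iff by (simp add: mem_box_cart)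
  note pos = test_function_Lp_power_pos[OF f this]
  have "Lp_power 2 f = L2sq f" by (simp add: Lp_power_def L2sq_def)
  then have m: "L2sq f > 0" using pos[of 2] by simp
  have H: "f \<in> H1" using f by (rule test_functions_H1)
  define a where "a = sqrt (c / L2sq f)"
  have a: "a > 0" using c m by (simp add: a_def)
  have "rescale a 1 f \<in> mass_sphere c"
    using L2sq_rescale[OF H, of 1 a] rescale_H1[OF H, of 1 a] c m by (simp add: mass_sphere_iff a_def)
  moreover have "Lp_power p (rescale a 1 f) > 0"
    using Lp_power_rescale[OF H, of 1 p a] pos[OF p] a by simp
  ultimately show ?thesis using that by blast
qed

context supercritical begin

text \<open>An admissible path is obtained by dilating one fixed function from a small parameter \<open>t\<close> to a
  large parameter \<open>T\<close>. Its energy is bounded, so the level is finite. By the geometry the level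
  exceeds the energy at the start, which is nonnegative for small \<open>t\<close> since \<open>\<sigma> > 2\<close>.\<close>

lemma mp_level_finite_pos:
  assumes geo: "mp_geometry TYPE('n) p K c" and c: "c > 0"
  shows "0 < mp_level TYPE('n) p K c" "mp_level TYPE('n) p K c < \<infinity>"
proof -
  have K: "K > 0" using geo by (simp add: mp_geometry_def)
  obtain u :: "real ^ 'n \<Rightarrow> real" where u: "u \<in> mass_sphere c" "Lp_power p u > 0"
    using mass_sphere_exists[OF c p_pos] by blast
  have H: "u \<in> H1" using u by (simp add: mass_sphere_iff)
  define \<alpha> \<beta> where "\<alpha> = grad_sq u / 2" and "\<beta> = Lp_power p u / p"
  have ab: "\<alpha> \<ge> 0" "\<beta> > 0" using p_pos u(2) by (simp_all add: \<alpha>_def \<beta>_def grad_sq_nonneg)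
  have en: "energy p (dilate s u) = \<alpha> * s\<^sup>2 - \<beta> * s powr \<sigma>" if "s > 0" for s
    using energy_along_dilation[OF H that] by (simp add: \<alpha>_def \<beta>_def)
  obtain T where T: "T \<ge> 1" "\<alpha> * T\<^sup>2 - \<beta> * T powr \<sigma> < 0"
    using fibre_map_eventually_negative[OF \<sigma>_gt ab(2)] by blast
  obtain t1 where t1: "0 < t1" "t1 \<le> 1" "\<And>s. 0 < s \<Longrightarrow> s \<le> t1 \<Longrightarrow> s\<^sup>2 * grad_sq u \<le> K"
    using small_dilation_parameter[OF K grad_sq_nonneg[of u]] by blast
  define h where "h t = (\<lambda>s. dilate (t + s * (T - t)) u)" for t
  have range: "t \<le> t + s * (T - t)" "t + s * (T - t) \<le> T" if "0 < t" "t \<le> t1" "s \<in> {0..1}" for s t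
  proof -
    have "t \<le> T" using that t1 T by linarith
    then have "0 \<le> s * (T - t)" using that by simp
    moreover have "s * (T - t) \<le> 1 * (T - t)" using that \<open>t \<le> T\<close> by (intro mult_right_mono) auto
    ultimately show "t \<le> t + s * (T - t)" "t + s * (T - t) \<le> T" by auto
  qed
  have h: "h t \<in> mp_paths p K c" if "0 < t" "t \<le> t1" for t
    unfolding h_def using T t1 that en[of T] u by (intro dilation_path) auto
  have low: "mp_level TYPE('n) p K c > ereal (energy p (dilate t u))" if "0 < t" "t \<le> t1" for t
  proof -
    have "mp_level TYPE('n) p K c > ereal (max (energy p (h t 0)) (energy p (h t 1)))"
      using geo h[OF that] by (simp add: mp_geometry_def)
    moreover have "energy p (dilate t u) \<le> max (energy p (h t 0)) (energy p (h t 1))" by (simp add: h_def)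
    ultimately show ?thesis by (meson ereal_less_eq(3) order_le_less_trans)
  qed
  have "mp_level TYPE('n) p K c \<le> ereal (\<alpha> * T\<^sup>2)"
  proof (rule mp_level_le[OF h[OF t1(1) order_refl]])
    fix s :: real assume s: "s \<in> {0..1}"
    let ?r = "t1 + s * (T - t1)"
    have r: "0 < ?r" "?r \<le> T" using range[OF t1(1) order_refl s] t1 by auto
    have "\<alpha> * ?r\<^sup>2 \<le> \<alpha> * T\<^sup>2" using r ab by (intro mult_left_mono power_mono) auto
    moreover have "0 \<le> \<beta> * ?r powr \<sigma>" using ab by simp
    ultimately have "energy p (dilate ?r u) \<le> \<alpha> * T\<^sup>2" unfolding en[OF r(1)] by linarith
    then show "ereal (energy p (h t1 s)) \<le> ereal (\<alpha> * T\<^sup>2)" by (simp add: h_def)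
  qed
  then show "mp_level TYPE('n) p K c < \<infinity>" by (rule order_le_less_trans) simp
  \<comment> \<open>A vanishing gradient would make the energy decrease along the whole dilation, against the geometry.\<close>
  have \<alpha>: "\<alpha> > 0"
  proof (rule ccontr)
    assume "\<not> \<alpha> > 0"
    then have a0: "\<alpha> = 0" using ab by simp
    have "mp_level TYPE('n) p K c \<le> ereal (energy p (dilate t1 u))"
    proof (rule mp_level_le[OF h[OF t1(1) order_refl]])
      fix s :: real assume s: "s \<in> {0..1}"
      let ?r = "t1 + s * (T - t1)"
      have r: "0 < ?r" "t1 \<le> ?r" using range[OF t1(1) order_refl s] t1 by auto
      have "\<beta> * t1 powr \<sigma> \<le> \<beta> * ?r powr \<sigma>"
        using r t1 ab \<sigma>_gt by (intro mult_left_mono powr_mono2) auto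
      then have "energy p (dilate ?r u) \<le> energy p (dilate t1 u)"
        unfolding en[OF r(1)] en[OF t1(1)] by (simp add: a0)
      then show "ereal (energy p (h t1 s)) \<le> ereal (energy p (dilate t1 u))" by (simp add: h_def)
    qed
    then show False using low[OF t1(1) order_refl] by simp
  qed
  \<comment> \<open>Below this threshold the gradient term of the fibre map outweighs the other one.\<close>
  define X where "X = \<alpha> / \<beta>"
  have X: "X > 0" using \<alpha> ab by (simp add: X_def)
  define t where "t = min t1 (X powr (1 / (\<sigma> - 2)))"
  have t: "0 < t" "t \<le> t1" using t1 X by (auto simp: t_def)
  have "t powr (\<sigma> - 2) \<le> (X powr (1 / (\<sigma> - 2))) powr (\<sigma> - 2)"
    using t \<sigma>_gt by (intro powr_mono2) (auto simp: t_def)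
  also have "\<dots> = X" using \<sigma>_gt X by (simp add: powr_powr)
  finally have "\<beta> * t powr (\<sigma> - 2) \<le> \<alpha>" using ab by (simp add: X_def pos_le_divide_eq mult.commute)
  then have "t\<^sup>2 * (\<beta> * t powr (\<sigma> - 2)) \<le> t\<^sup>2 * \<alpha>" by (intro mult_left_mono) auto
  moreover have "t powr \<sigma> = t\<^sup>2 * t powr (\<sigma> - 2)" using t powr_add[of t 2 "\<sigma> - 2"] by simp
  ultimately have "0 \<le> energy p (dilate t u)" unfolding en[OF t(1)] by (simp add: algebra_simps)
  then have "ereal 0 \<le> ereal (energy p (dilate t u))" by simp
  then show "0 < mp_level TYPE('n) p K c"
    using low[OF t] unfolding zero_ereal_def by (rule order_le_less_trans)
qed

section \<open>The power law for the level\<close>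

text \<open>The rescaling with \<open>a powr (2 - \<sigma>) = c\<close> carries mass \<open>1\<close> to mass \<open>c\<close>, but the bound \<open>K 1\<close>
  need not be carried to \<open>K c\<close>. A bound \<open>K1\<close> that is admissible for both is obtained by
  shrinking, which leaves both levels unchanged by \<open>mp_level_shrink\<close>.\<close>

lemma mp_level_power_law:
  assumes geo: "\<And>c. c > 0 \<Longrightarrow> mp_geometry TYPE('n) p (K c) c"
  obtains L where "L > 0"
    "\<And>c. c > 0 \<Longrightarrow> mp_level TYPE('n) p (K c) c = ereal (L * c powr (- ((p - \<sigma>) / (\<sigma> - 2))))"
proof -
  define \<gamma> where "\<gamma> = mp_level TYPE('n) p (K 1) 1"
  have "0 < \<gamma>" "\<gamma> < \<infinity>" unfolding \<gamma>_def using mp_level_finite_pos[OF geo] by auto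
  then obtain L where L: "\<gamma> = ereal L" "L > 0" by (cases \<gamma>) auto
  have "mp_level TYPE('n) p (K c) c = ereal (L * c powr (- ((p - \<sigma>) / (\<sigma> - 2))))" if c: "c > 0" for c
  proof -
    define a where "a = c powr (1 / (2 - \<sigma>))"
    have a: "a > 0" using c by (simp add: a_def)
    define s where "s = a powr (p - \<sigma>)"
    have s: "s > 0" using a by (simp add: s_def)
    have ac: "a powr (2 - \<sigma>) = c" using c \<sigma>_gt by (simp add: a_def powr_powr)
    have "1 / (2 - \<sigma>) * (p - \<sigma>) = - ((p - \<sigma>) / (\<sigma> - 2))"
      using \<sigma>_gt by (simp add: field_simps)
    then have sc: "s = c powr (- ((p - \<sigma>) / (\<sigma> - 2)))"
      unfolding s_def a_def powr_powr by simp
    have K: "K c > 0" "K 1 > 0" using geo[of c] geo[of 1] c by (simp_all add: mp_geometry_def)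
    define K1 where "K1 = min (K c / s) (K 1)"
    have K1: "0 < K1" "K1 \<le> K 1" "0 < s * K1" "s * K1 \<le> K c"
      using K s by (auto simp: K1_def min_def field_simps)
    have "mp_level TYPE('n) p (K c) c = mp_level TYPE('n) p (s * K1) c"
      using mp_level_shrink[OF geo[OF c] K1(3,4)] by simp
    also have "\<dots> = ereal s * mp_level TYPE('n) p K1 1"
      using mp_level_scale[OF a, of K1 1] by (simp add: ac s_def)
    also have "mp_level TYPE('n) p K1 1 = \<gamma>"
      unfolding \<gamma>_def using mp_level_shrink[OF geo[of 1] K1(1,2)] by simp
    finally show ?thesis by (simp add: L sc mult.commute)
  qed
  then show ?thesis using that L(2) by blast
qed

end

theorem lemma9p3:
  fixes p :: real and K :: "real \<Rightarrow> real"
  defines "N \<equiv> real CARD('n::finite)"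
  assumes "(2 * N + 4) / N < p"
    and "N \<ge> 3 \<Longrightarrow> p < 2 * N / (N - 2)"
    and "\<And>c. c > 0 \<Longrightarrow> mp_geometry TYPE('n) p (K c) c"
  shows "strict_antimono_on {0<..} (\<lambda>c. mp_level TYPE('n) p (K c) c)
    \<and> ((\<lambda>c. mp_level TYPE('n) p (K c) c) \<longlongrightarrow> \<infinity>) (at_right 0)
    \<and> ((\<lambda>c. mp_level TYPE('n) p (K c) c) \<longlongrightarrow> 0) at_top"
proof -
  have N: "N \<ge> 1" by (simp add: N_def Suc_leI)
  have low: "N * (p - 2) > 4" using assms(2) N by (simp add: field_simps)
  have "N * (p - 2) / 2 < p"
  proof (cases "N \<ge> 3")
    case True
    then show ?thesis using assms(3) by (simp add: field_simps)
  next
    case False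
    \<comment> \<open>In dimensions one and two the bound holds for every \<open>p > 2\<close>.\<close>
    then have "CARD('n) < 3" by (simp add: N_def)
    then have "N \<le> 2" by (simp add: N_def)
    moreover have "p > 2" using low N by (smt (verit) mult_nonneg_nonpos)
    ultimately have "N * (p - 2) \<le> 2 * (p - 2)" by (intro mult_right_mono) auto
    then show ?thesis by simp
  qed
  then interpret supercritical p "TYPE('n)"
    using low by unfold_locales (simp_all add: N_def)
  define \<beta> where "\<beta> = (p - \<sigma>) / (\<sigma> - 2)"
  have \<beta>: "\<beta> > 0" using \<sigma>_gt p_subcritical by (simp add: \<beta>_def \<sigma>_def)
  obtain L where L: "L > 0"
    and eq: "\<And>c. c > 0 \<Longrightarrow> mp_level TYPE('n) p (K c) c = ereal (L * c powr - \<beta>)"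
    using mp_level_power_law[OF assms(4)] unfolding \<beta>_def by blast
  have "strict_antimono_on {0<..} (\<lambda>c. mp_level TYPE('n) p (K c) c)"
  proof (rule monotone_onI)
    fix x y :: real assume xy: "x \<in> {0<..}" "y \<in> {0<..}" "x < y"
    then have "y powr - \<beta> < x powr - \<beta>" using \<beta> by (intro powr_less_mono2_neg) auto
    then show "mp_level TYPE('n) p (K y) y < mp_level TYPE('n) p (K x) x"
      using xy L by (simp add: eq)
  qed
  moreover have "((\<lambda>c. mp_level TYPE('n) p (K c) c) \<longlongrightarrow> \<infinity>) (at_right 0)"
  proof -
    have "filterlim (\<lambda>c. L * c powr - \<beta>) at_top (at_right 0)"
      using \<beta> L by real_asymp
    then have "((\<lambda>c. ereal (L * c powr - \<beta>)) \<longlongrightarrow> \<infinity>) (at_right 0)"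
      by (simp add: tendsto_PInfty_eq_at_top)
    moreover have "\<forall>\<^sub>F c in at_right 0. ereal (L * c powr - \<beta>) = mp_level TYPE('n) p (K c) c"
      using eventually_at_right_less[of 0] by eventually_elim (simp add: eq)
    ultimately show ?thesis by (rule Lim_transform_eventually)
  qed
  moreover have "((\<lambda>c. mp_level TYPE('n) p (K c) c) \<longlongrightarrow> 0) at_top"
  proof -
    have "((\<lambda>c. L * c powr - \<beta>) \<longlongrightarrow> 0) at_top"
      using \<beta> L by real_asymp
    then have "((\<lambda>c. ereal (L * c powr - \<beta>)) \<longlongrightarrow> ereal 0) at_top" by (rule tendsto_ereal)
    moreover have "\<forall>\<^sub>F c in at_top. ereal (L * c powr - \<beta>) = mp_level TYPE('n) p (K c) c"
      using eventually_gt_at_top[of 0] by eventually_elim (simp add: eq)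
    ultimately show ?thesis unfolding zero_ereal_def by (rule Lim_transform_eventually)
  qed
  ultimately show ?thesis by blast
qed

end
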